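(* Define integers $b_{21}(n)$ by $\sum_{n\ge 0} b_{21}(n)q^n = \prod_{i\ge 1}\frac{1-q^{21i}}{1-q^{i}}$, and set $b_{21}(m)=0$ for $m<0$. Let $p$ be a prime with $$p\equiv 19, 37, 47, 65, 85, 109, 113, 115, 137, 139, 143, \text{ or } 167 \pmod{168},$$ and let $c$ be an integer with $24c\equiv 1 \pmod{p^2}$. Then $$b_{21}\bigl(4(p^2 n + kp - 5c)\bigr)\equiv 0 \pmod 2$$ for all integers $n\ge 0$ and all $1\le k<p$.
   Context: For example, for $p=19$ this gives $b_{21}(4\cdot 19^2 n+76k+300)\equiv 0\pmod 2$ for $1\le k\le 18$. *)

theory Defs
  imports
    "HOL-Analysis.Infinite_Products"
    "HOL-Computational_Algebra.Formal_Power_Series"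
    "HOL-Number_Theory.Cong"
begin

(* The factor (1 - q^(21 i)) / (1 - q^i) for i = k + 1: the library's infinite products are
   indexed from 0. The coefficients are rational because the library only provides division of
   formal power series when the coefficient type has an inverse. *)
definition b21_factor :: "nat \<Rightarrow> rat fps" where
  "b21_factor k = (1 - fps_X ^ (21 * Suc k)) / (1 - fps_X ^ Suc k)"

(* The infinite product is taken in the library's topology on formal power series, in which
   convergence means that every coefficient is eventually constant. The floor only turns an
   integer in rat into an int: see b21_generating_function. *)
definition b21 :: "int \<Rightarrow> int" where
  "b21 m = (if m < 0 then 0 else \<lfloor>fps_nth (prodinf b21_factor) (nat m)\<rfloor>)"

lemma b21_factor_eq: "b21_factor k = (\<Sum>j<21. (fps_X ^ Suc k) ^ j)"
proof -
  let ?x = "fps_X ^ Suc k :: rat fps"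
  have "fps_nth (1 - ?x) 0 \<noteq> 0"
    by simp
  hence nz: "1 - ?x \<noteq> 0"
    by (metis fps_zero_nth)
  have "1 - fps_X ^ (21 * Suc k) = 1 - ?x ^ 21"
    by (simp only: power_mult[symmetric] mult.commute[of 21])
  also have "\<dots> = (\<Sum>j<21. ?x ^ j) * (1 - ?x)"
    by (subst one_diff_power_eq, rule mult.commute)
  finally show ?thesis
    unfolding b21_factor_def by (simp only: fps_divide_times_eq[OF nz])
qed

lemma b21_factor_Ints: "fps_nth (b21_factor k) n \<in> \<int>"
  by (auto simp: b21_factor_eq fps_sum_nth power_mult[symmetric] fps_X_power_nth
           simp del: power_Suc intro!: Ints_sum)

lemma b21_partial_product_Ints: "fps_nth (\<Prod>k\<le>N. b21_factor k) n \<in> \<int>"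
proof (induction N arbitrary: n)
  case 0
  show ?case by (simp add: b21_factor_Ints)
next
  case (Suc N)
  show ?case
    by (auto simp: fps_mult_nth intro!: Ints_sum Ints_mult Suc.IH b21_factor_Ints)
qed

lemma b21_partial_product_Suc:
  assumes "n \<le> N"
  shows "fps_nth (\<Prod>k\<le>Suc N. b21_factor k) n = fps_nth (\<Prod>k\<le>N. b21_factor k) n"
proof -
  let ?P = "\<Prod>k\<le>N. b21_factor k"
  let ?x = "fps_X ^ Suc (Suc N) :: rat fps"
  have *: "b21_factor (Suc N) = 1 + ?x * (\<Sum>j<20. ?x ^ j)"
  proof -
    have "(\<Sum>j<Suc 20. ?x ^ j) = 1 + ?x * (\<Sum>j<20. ?x ^ j)"
      by (simp only: sum.lessThan_Suc_shift power_0 power_Suc[of ?x] sum_distrib_left)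
    thus ?thesis
      by (simp add: b21_factor_eq del: power_Suc)
  qed
  have "(\<Prod>k\<le>Suc N. b21_factor k) = ?P * b21_factor (Suc N)"
    by simp
  also have "\<dots> = ?P + ?x * (?P * (\<Sum>j<20. ?x ^ j))"
    unfolding * by (simp only: distrib_left mult_1_right mult.left_commute)
  finally have "fps_nth (\<Prod>k\<le>Suc N. b21_factor k) n
      = fps_nth (?P + ?x * (?P * (\<Sum>j<20. ?x ^ j))) n"
    by (rule arg_cong)
  also have "\<dots> = fps_nth ?P n"
    using assms by (simp only: fps_add_nth fps_X_power_mult_nth) simp
  finally show ?thesis .
qed

lemma b21_factor_has_prod:
  "b21_factor has_prod Abs_fps (\<lambda>n. fps_nth (\<Prod>k\<le>n. b21_factor k) n)"
proof -
  let ?G = "Abs_fps (\<lambda>n. fps_nth (\<Prod>k\<le>n. b21_factor k) n)"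
  have stable: "fps_nth (\<Prod>k\<le>N. b21_factor k) n = fps_nth (\<Prod>k\<le>n. b21_factor k) n"
    if "n \<le> N" for n N
    using that
  proof (induction N rule: dec_induct)
    case base
    show ?case by (rule refl)
  next
    case (step N)
    then show ?case by (simp only: b21_partial_product_Suc)
  qed
  have lim: "(\<lambda>N. \<Prod>k\<le>N. b21_factor k) \<longlonglongrightarrow> ?G"
  proof (rule tendsto_fpsI)
    fix n
    show "\<forall>\<^sub>F N in sequentially. fps_nth (\<Prod>k\<le>N. b21_factor k) n = fps_nth ?G n"
      using eventually_ge_at_top[of n] by eventually_elim (simp only: fps_nth_Abs_fps, erule stable)
  qed
  have "fps_nth ?G 0 = fps_nth (b21_factor 0) 0"
    by simp
  also have "\<dots> = 1"
    by (simp add: b21_factor_eq fps_sum_nth fps_X_power_nth)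
  finally have "?G \<noteq> 0"
    by (metis fps_zero_nth zero_neq_one)
  with lim show ?thesis
    by (simp add: has_prod_def raw_has_prod_def)
qed

lemma b21_generating_function:
  "b21_factor has_prod Abs_fps (\<lambda>n. of_int (b21 (int n)))"
proof -
  let ?G = "Abs_fps (\<lambda>n. fps_nth (\<Prod>k\<le>n. b21_factor k) n)"
  have G: "prodinf b21_factor = ?G"
    using has_prod_unique[OF b21_factor_has_prod] by simp
  have "Abs_fps (\<lambda>n. of_int (b21 (int n))) = ?G"
    by (rule fps_ext) (simp add: b21_def G b21_partial_product_Ints)
  thus ?thesis
    using b21_factor_has_prod by simp
qed

end

(* Everything happens modulo 2. Write a, b, c, d for the Euler products of q, q^3, q^7, q^21 over
   the field with two elements, where f(q^2) = f(q)^2. The triple product gives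
   sum_j q^(3j^2-2j) = b^3/a =: theta and sum_j q^(2j^2-j) = a^3. Splitting the first sum by the
   parity of j gives theta = a^8 + q theta^4, and an involution coming from the splitting of 2 in
   the ring of integers of Q(sqrt(-7)) gives a c = a^8 + q a^4 c^4 + q^2 c^8. With q replaced by q^3
   in the latter, d/a = (b d) theta / b^4 is a sum of monomials q^i times fourth powers, so the
   4-dissection can be read off: the part with exponents divisible by 4 is the fourth power of
   a^2 b + q theta d. Hence if b21(4m) is odd then 24 m + 5 is of the form 2x^2 + 3y^2 or
   8x^2 + 21y^2. For the given p neither -6 nor -42 is a square modulo p, so p cannot divide
   24 m + 5 exactly once, which it does for m = p^2 n + k p - 5 c. *)
theory Submission
  imports Defs "HOL-Library.Z2" "HOL-Library.Disjoint_Sets"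
    "HOL-Computational_Algebra.Formal_Laurent_Series" "HOL-Number_Theory.Quadratic_Reciprocity"
begin

section \<open>Euler products as formal power series\<close>

lemma fps_tendsto_mult:
  fixes f g :: "'b \<Rightarrow> 'a::ring_1 fps"
  assumes "(f \<longlongrightarrow> F) L" "(g \<longlongrightarrow> G) L"
  shows "((\<lambda>x. f x * g x) \<longlongrightarrow> F * G) L"
proof (rule tendsto_fpsI)
  fix n
  have "\<forall>\<^sub>F x in L. \<forall>i\<in>{..n}. fps_nth (f x) i = fps_nth F i"
    by (subst eventually_ball_finite_distrib) (use assms in \<open>auto simp: tendsto_fps_iff\<close>)
  moreover have "\<forall>\<^sub>F x in L. \<forall>i\<in>{..n}. fps_nth (g x) i = fps_nth G i"
    by (subst eventually_ball_finite_distrib) (use assms in \<open>auto simp: tendsto_fps_iff\<close>)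
  ultimately show "\<forall>\<^sub>F x in L. fps_nth (f x * g x) n = fps_nth (F * G) n"
    by eventually_elim (auto simp: fps_mult_nth intro!: sum.cong)
qed

lemma fps_tendsto_compose_X_power:
  fixes f :: "'b \<Rightarrow> 'a::comm_ring_1 fps"
  assumes "(f \<longlongrightarrow> F) L"
  shows "((\<lambda>x. f x oo fps_X ^ k) \<longlongrightarrow> F oo fps_X ^ k) L"
  using assms unfolding tendsto_fps_iff fps_nth_compose_X_power
  by (auto elim: eventually_mono)

definition euler_partial :: "nat \<Rightarrow> 'a::comm_ring_1 fps" where
  "euler_partial m = (\<Prod>i<m. 1 - fps_X ^ Suc i)"

text \<open>The infinite product of all 1 - q^i. The diagonal is meaningful because factors after
  the n-th leave coefficient n alone, see \<open>euler_partial_nth_eq\<close>.\<close>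

definition euler_fps :: "'a::comm_ring_1 fps" where
  "euler_fps = Abs_fps (\<lambda>n. fps_nth (euler_partial n) n)"

lemma euler_partial_0 [simp]: "euler_partial 0 = 1"
  by (simp add: euler_partial_def)

lemma euler_partial_Suc: "euler_partial (Suc m) = euler_partial m * (1 - fps_X ^ Suc m)"
  by (simp add: euler_partial_def)

lemma euler_partial_nth_eq:
  assumes "n \<le> m"
  shows "fps_nth (euler_partial m) n = fps_nth euler_fps n"
  using assms
proof (induction m rule: dec_induct)
  case base
  show ?case by (simp add: euler_fps_def)
next
  case (step m)
  then show ?case
    by (simp add: euler_partial_Suc right_diff_distrib fps_X_power_mult_right_nth
        del: power_Suc)
qed

lemma euler_partial_tendsto:
  "filterlim g at_top L \<Longrightarrow> ((\<lambda>N. euler_partial (g N)) \<longlongrightarrow> euler_fps) L"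
proof (rule tendsto_fpsI)
  fix n assume "filterlim g at_top L"
  then have "\<forall>\<^sub>F N in L. n \<le> g N"
    by (simp add: filterlim_at_top)
  then show "\<forall>\<^sub>F N in L. fps_nth (euler_partial (g N)) n = fps_nth euler_fps n"
    by eventually_elim (rule euler_partial_nth_eq)
qed

lemma euler_fps_nth_0 [simp]: "fps_nth euler_fps 0 = 1"
  by (simp add: euler_fps_def)

lemma fps_compose_X_power_diff_power:
  fixes s :: nat assumes "s > 0"
  shows "(1 - fps_X ^ k :: 'a::idom fps) oo fps_X ^ s = 1 - fps_X ^ (s * k)"
  using assms by (simp add: fps_compose_sub_distrib fps_X_power_compose power_mult)

lemma euler_partial_compose:
  fixes s :: nat assumes "s > 0"
  shows "(euler_partial m :: 'a::idom fps) oo fps_X ^ s = (\<Prod>i<m. 1 - fps_X ^ (s * Suc i))"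
  using assms unfolding euler_partial_def
  by (simp add: fps_compose_prod_distrib fps_compose_X_power_diff_power del: power_Suc mult_Suc_right)

section \<open>The triple product identity\<close>

text \<open>Gaussian binomial coefficients, given by a Pascal rule so that they make sense over
  every commutative ring without dividing by 1 - q^i.\<close>

fun qbinomial :: "'a::comm_ring_1 \<Rightarrow> nat \<Rightarrow> nat \<Rightarrow> 'a" where
  "qbinomial q n 0 = 1"
| "qbinomial q 0 (Suc k) = 0"
| "qbinomial q (Suc n) (Suc k) = qbinomial q n (Suc k) + q ^ (n - k) * qbinomial q n k"

lemma qbinomial_eq_0: "n < k \<Longrightarrow> qbinomial q n k = 0"
  by (induction q n k rule: qbinomial.induct) auto

text \<open>In the induction step the two terms of the Pascal rule contribute the factors 1 -
  q^(n-k) and q^(n-k) (1 - q^(k+1)), which add up to 1 - q^(n+1).\<close>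

lemma qbinomial_factorials:
  "k \<le> n \<Longrightarrow> qbinomial q n k * (\<Prod>i<k. 1 - q ^ Suc i) * (\<Prod>i<n - k. 1 - q ^ Suc i)
    = (\<Prod>i<n. 1 - q ^ Suc i)"
proof (induction q n k rule: qbinomial.induct)
  case (3 q n k)
  let ?P = "\<lambda>m. \<Prod>i<m. 1 - q ^ Suc i"
  have "k \<le> n" using 3 by simp
  have A: "qbinomial q n (Suc k) * ?P (Suc k) * ?P (n - k) = ?P n * (1 - q ^ (n - k))"
  proof (cases "k = n")
    case True
    then show ?thesis by (simp add: qbinomial_eq_0)
  next
    case False
    then have "n - k = Suc (n - Suc k)" "Suc k \<le> n" using \<open>k \<le> n\<close> by auto
    then have "?P (n - k) = ?P (n - Suc k) * (1 - q ^ (n - k))"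
      by simp
    then show ?thesis
      by (simp only: "3.IH"(1)[OF \<open>Suc k \<le> n\<close>] mult.assoc[symmetric])
  qed
  have B: "qbinomial q n k * ?P (Suc k) * ?P (n - k) = ?P n * (1 - q ^ Suc k)"
  proof -
    have "qbinomial q n k * ?P (Suc k) * ?P (n - k)
      = (qbinomial q n k * ?P k * ?P (n - k)) * (1 - q ^ Suc k)"
      by (simp only: prod.lessThan_Suc mult_ac)
    then show ?thesis
      by (simp only: "3.IH"(2)[OF \<open>k \<le> n\<close>])
  qed
  have "q ^ (n - k) * q ^ Suc k = q ^ Suc n"
    using \<open>k \<le> n\<close> by (simp del: power_Suc flip: power_add)
  have "qbinomial q (Suc n) (Suc k) * ?P (Suc k) * ?P (Suc n - Suc k)
    = qbinomial q n (Suc k) * ?P (Suc k) * ?P (n - k)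
      + q ^ (n - k) * (qbinomial q n k * ?P (Suc k) * ?P (n - k))"
    by (simp only: qbinomial.simps diff_Suc_Suc) (simp only: algebra_simps)
  also have "\<dots> = ?P n * (1 - q ^ (n - k) * q ^ Suc k)"
    unfolding A B by (simp add: algebra_simps)
  also have "\<dots> = ?P (Suc n)"
    unfolding \<open>q ^ (n - k) * q ^ Suc k = q ^ Suc n\<close> by simp
  finally show ?case .
qed auto

text \<open>The Pascal rule splits the sum for \<open>Suc n\<close> into y times and x q^n times the
  sum for n, so the new factor y + x q^n comes out.\<close>

lemma qbinomial_theorem:
  "(\<Prod>i<n. y + x * q ^ i) = (\<Sum>k\<le>n. qbinomial q n k * q ^ (k * (k - 1) div 2) * x ^ k * y ^ (n - k))"
proof (induction n)
  case (Suc n)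
  have tri: "Suc k * (Suc k - 1) div 2 = k + k * (k - 1) div 2" for k :: nat
  proof -
    have "Suc k * (Suc k - 1) = k * 2 + k * (k - 1)"
      by (cases k) auto
    then show ?thesis by (metis div_mult_self3 zero_neq_numeral)
  qed
  define f where "f k = q ^ (k * (k - 1) div 2)" for k :: nat
  have fS: "f (Suc k) = q ^ k * f k" for k
    unfolding f_def tri by (simp add: power_add)
  have "(\<Sum>k\<le>Suc n. qbinomial q (Suc n) k * f k * x ^ k * y ^ (Suc n - k))
    = y ^ Suc n + (\<Sum>k\<le>n. qbinomial q (Suc n) (Suc k) * f (Suc k) * x ^ Suc k * y ^ (n - k))"
    by (subst sum.atMost_Suc_shift) (simp add: f_def)
  also have "\<dots> = (y ^ Suc n + (\<Sum>k\<le>n. qbinomial q n (Suc k) * f (Suc k) * x ^ Suc k * y ^ (n - k)))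
     + (\<Sum>k\<le>n. q ^ (n - k) * qbinomial q n k * f (Suc k) * x ^ Suc k * y ^ (n - k))"
    by (simp add: distrib_right sum.distrib add.assoc)
  also have "y ^ Suc n + (\<Sum>k\<le>n. qbinomial q n (Suc k) * f (Suc k) * x ^ Suc k * y ^ (n - k))
     = (\<Sum>k\<le>Suc n. qbinomial q n k * f k * x ^ k * y ^ (Suc n - k))"
    by (simp only: sum.atMost_Suc_shift) (simp add: f_def)
  also have "\<dots> = y * (\<Sum>k\<le>n. qbinomial q n k * f k * x ^ k * y ^ (n - k))"
    by (simp add: qbinomial_eq_0 sum_distrib_left Suc_diff_le mult_ac)
  also have "(\<Sum>k\<le>n. q ^ (n - k) * qbinomial q n k * f (Suc k) * x ^ Suc k * y ^ (n - k))
     = x * q ^ n * (\<Sum>k\<le>n. qbinomial q n k * f k * x ^ k * y ^ (n - k))"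
    unfolding sum_distrib_left
  proof (intro sum.cong refl)
    fix k assume "k \<in> {..n}"
    then have "q ^ n = q ^ (n - k) * q ^ k" by (simp flip: power_add)
    then show "q ^ (n - k) * qbinomial q n k * f (Suc k) * x ^ Suc k * y ^ (n - k)
        = x * q ^ n * (qbinomial q n k * f k * x ^ k * y ^ (n - k))"
      by (simp add: fS mult_ac)
  qed
  finally show ?case
    using Suc by (simp add: f_def algebra_simps)
qed simp

text \<open>\<open>card\<close> is 0 on infinite sets, so products and disjoint unions of such
  series ask for finite fibres.\<close>

definition weight_gf :: "('b \<Rightarrow> nat) \<Rightarrow> 'b set \<Rightarrow> 'a::semiring_1 fps" where
  "weight_gf w S = Abs_fps (\<lambda>n. of_nat (card {x \<in> S. w x = n}))"

text \<open>Exponents in Jacobi's triple product with base q^s and variable q^t. For 0 < t < s the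
  integer inside \<open>nat\<close> is nonnegative by \<open>theta_exp_ge\<close>.\<close>

definition theta_exp :: "nat \<Rightarrow> nat \<Rightarrow> int \<Rightarrow> nat" where
  "theta_exp s t j = nat (int s * (j * (j - 1) div 2) + int t * j)"

lemma triangle_int: "2 * (j * (j - 1) div 2) = j * (j - 1)" for j :: int
  by (rule dvd_mult_div_cancel) simp

text \<open>For j < 0 the triangular number is at least -j, which leaves (s - t)(-j). The linear
  bound shows that \<open>nat\<close> truncates nothing, that fibres are finite, and that only |j|
  <= n matters for coefficient n.\<close>

lemma theta_exp_ge:
  assumes "0 < t" "t < s"
  shows "\<bar>j\<bar> \<le> int s * (j * (j - 1) div 2) + int t * j"
proof (cases "j \<ge> 0")
  case True
  then have "0 \<le> j * (j - 1)"
    by (cases "j = 0") auto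
  then have "0 \<le> int s * (j * (j - 1) div 2)"
    by simp
  moreover have "1 * j \<le> int t * j"
    using True assms by (intro mult_right_mono) auto
  ultimately show ?thesis using True by simp
next
  case False
  have "(- j) * 2 \<le> (- j) * (1 - j)"
    using False by (intro mult_left_mono) auto
  then have "- j \<le> j * (j - 1) div 2"
    using triangle_int[of j] by (simp add: algebra_simps)
  then have "int s * (- j) \<le> int s * (j * (j - 1) div 2)"
    by (intro mult_left_mono) auto
  moreover have "1 * (- j) \<le> (int s - int t) * (- j)"
    using False assms by (intro mult_right_mono) auto
  ultimately show ?thesis using False by (simp add: algebra_simps)
qed

lemma theta_exp_int:
  assumes "0 < t" "t < s"
  shows "int (theta_exp s t j) = int s * (j * (j - 1) div 2) + int t * j"
  using theta_exp_ge[OF assms, of j] by (simp add: theta_exp_def)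

lemma theta_exp_int2:
  assumes "0 < t" "t < s"
  shows "2 * int (theta_exp s t j) = int s * (j * (j - 1)) + 2 * int t * j"
proof -
  have "2 * int (theta_exp s t j) = int s * (2 * (j * (j - 1) div 2)) + 2 * int t * j"
    unfolding theta_exp_int[OF assms] by (simp only: distrib_left mult_ac)
  then show ?thesis by (simp only: triangle_int)
qed

lemma theta_exp_abs_le:
  assumes "0 < t" "t < s"
  shows "\<bar>j\<bar> \<le> int (theta_exp s t j)"
  using theta_exp_ge[OF assms] by (simp add: theta_exp_int[OF assms])

lemma finite_theta_exp:
  assumes "0 < t" "t < s"
  shows "finite {j. theta_exp s t j = n}"
proof (rule finite_subset)
  show "{j. theta_exp s t j = n} \<subseteq> {- int n..int n}"
    using theta_exp_abs_le[OF assms] by (auto simp: abs_le_iff minus_le_iff)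
qed simp

lemma prod_lessThan_add:
  fixes f :: "nat \<Rightarrow> 'a::comm_monoid_mult"
  shows "(\<Prod>i<m + n. f i) = (\<Prod>i<m. f i) * (\<Prod>i<n. f (m + i))"
  by (induction n) (simp_all add: mult_ac)

text \<open>The q-binomial theorem with 2N factors, indexed from the centre. Factors with index
  below N, in reverse order, yield the exponents s(n+1) - t, the others the exponents s n +
  t.\<close>

lemma finite_triple_product:
  fixes s t N :: nat
  assumes "0 < t" "t < s"
  shows "(\<Prod>n<N. (1 + fps_X ^ (s * n + t)) * (1 + fps_X ^ (s * Suc n - t)))
    = (\<Sum>k\<le>2 * N. qbinomial (fps_X ^ s) (2 * N) k * fps_X ^ theta_exp s t (int k - int N)
        :: 'a::idom fps)"
    (is "?P = ?S")
proof -
  let ?X = "fps_X :: 'a fps"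
  \<comment> \<open>The q-binomial theorem is applied with \<open>y = X^(s N)\<close> and \<open>x = X^t\<close> instead of \<open>1\<close> and
    \<open>X^(t - s N)\<close>, so that no negative powers occur; both sides then carry the factor \<open>X^E\<close>.\<close>
  define E where "E = (\<Sum>i<N. t + s * i) + s * N * N"
  have "(\<Prod>i<N. ?X ^ (s * N) + ?X ^ t * (?X ^ s) ^ i)
      = (\<Prod>i<N. ?X ^ (t + s * i) * (1 + ?X ^ (s * Suc (N - Suc i) - t)))"
  proof (intro prod.cong refl)
    fix i assume "i \<in> {..<N}"
    then obtain d where d: "N = Suc i + d" by (auto dest: less_imp_Suc_add)
    have "(t + s * i) + (s * Suc (N - Suc i) - t) = s * N"
      using assms by (simp add: d algebra_simps)
    then show "?X ^ (s * N) + ?X ^ t * (?X ^ s) ^ i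
        = ?X ^ (t + s * i) * (1 + ?X ^ (s * Suc (N - Suc i) - t))"
      by (simp add: distrib_left power_add[symmetric] power_mult[symmetric] add.commute
          del: mult_Suc_right)
  qed
  also have "\<dots> = ?X ^ (\<Sum>i<N. t + s * i) * (\<Prod>i<N. 1 + ?X ^ (s * Suc i - t))"
    by (simp only: prod.distrib power_sum
        prod.nat_diff_reindex[of "\<lambda>i. 1 + ?X ^ (s * Suc i - t)"])
  finally have 1: "(\<Prod>i<N. ?X ^ (s * N) + ?X ^ t * (?X ^ s) ^ i)
      = ?X ^ (\<Sum>i<N. t + s * i) * (\<Prod>i<N. 1 + ?X ^ (s * Suc i - t))" .
  have "(\<Prod>i<N. ?X ^ (s * N) + ?X ^ t * (?X ^ s) ^ (N + i))
      = (\<Prod>i<N. ?X ^ (s * N) * (1 + ?X ^ (s * i + t)))"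
  proof (intro prod.cong refl)
    fix i
    have "t + s * (N + i) = s * N + (s * i + t)" by (simp add: algebra_simps)
    then show "?X ^ (s * N) + ?X ^ t * (?X ^ s) ^ (N + i) = ?X ^ (s * N) * (1 + ?X ^ (s * i + t))"
      by (simp only: distrib_left mult_1_right power_add[symmetric] power_mult[symmetric])
  qed
  also have "\<dots> = ?X ^ (s * N * N) * (\<Prod>i<N. 1 + ?X ^ (s * i + t))"
    by (simp add: prod.distrib power_mult)
  finally have 2: "(\<Prod>i<N. ?X ^ (s * N) + ?X ^ t * (?X ^ s) ^ (N + i))
      = ?X ^ (s * N * N) * (\<Prod>i<N. 1 + ?X ^ (s * i + t))" .
  have "?X ^ E * ?P = (\<Prod>i<2 * N. ?X ^ (s * N) + ?X ^ t * (?X ^ s) ^ i)"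
    unfolding mult_2 prod_lessThan_add 1 2 prod.distrib
    by (simp only: E_def power_add[of ?X "\<Sum>i<N. t + s * i"]) (simp only: mult_ac)
  also have "\<dots> = (\<Sum>k\<le>2 * N. qbinomial (?X ^ s) (2 * N) k * (?X ^ s) ^ (k * (k - 1) div 2)
      * (?X ^ t) ^ k * (?X ^ (s * N)) ^ (2 * N - k))"
    by (rule qbinomial_theorem)
  also have "\<dots> = (\<Sum>k\<le>2 * N. ?X ^ E *
      (qbinomial (?X ^ s) (2 * N) k * ?X ^ theta_exp s t (int k - int N)))"
  proof (intro sum.cong refl)
    fix k assume "k \<in> {..2 * N}"
    then have k: "int (2 * N - k) = 2 * int N - int k" by simp
    \<comment> \<open>Doubling all exponents removes the divisions by two; the truncated m - 1 at m
      = 0 is multiplied by 0.\<close>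
    have tri: "2 * int (m * (m - 1) div 2) = int m * (int m - 1)" for m
      by (cases m) (simp_all add: zdiv_int triangle_int algebra_simps)
    define j where "j = int k - int N"
    have sumE: "2 * int (\<Sum>i<N. t + s * i) = 2 * int t * int N + int s * (int N * (int N - 1))"
      by (induction N) (simp_all add: algebra_simps)
    have "2 * int (s * (k * (k - 1) div 2) + t * k + s * N * (2 * N - k))
        = int s * (2 * int (k * (k - 1) div 2)) + 2 * int t * int k
          + 2 * int s * int N * int (2 * N - k)"
      by (simp only: of_nat_add of_nat_mult distrib_left mult_ac)
    also have "\<dots> = 2 * int (E + theta_exp s t j)"
      unfolding tri k of_nat_add distrib_left theta_exp_int2[OF assms] E_def sumE
      by (simp add: j_def algebra_simps)
    finally have "s * (k * (k - 1) div 2) + t * k + s * N * (2 * N - k) = E + theta_exp s t j"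
      by (simp only: mult_left_cancel of_nat_eq_iff zero_neq_numeral[symmetric] not_False_eq_True)
    then have "?X ^ (s * (k * (k - 1) div 2)) * ?X ^ (t * k) * ?X ^ (s * N * (2 * N - k))
        = ?X ^ E * ?X ^ theta_exp s t j"
      by (simp only: power_add[symmetric])
    then show "qbinomial (?X ^ s) (2 * N) k * (?X ^ s) ^ (k * (k - 1) div 2)
          * (?X ^ t) ^ k * (?X ^ (s * N)) ^ (2 * N - k)
        = ?X ^ E * (qbinomial (?X ^ s) (2 * N) k * ?X ^ theta_exp s t (int k - int N))"
      by (simp only: power_mult[symmetric] j_def[symmetric] mult.assoc
          mult.left_commute[of "?X ^ E"])
  qed
  also have "\<dots> = ?X ^ E * ?S"
    by (simp add: sum_distrib_left)
  finally show ?thesis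
    by (simp del: mult_Suc_right)
qed

text \<open>Congruence modulo X^(n+1).\<close>

definition fps_agree :: "nat \<Rightarrow> 'a::semiring_1 fps \<Rightarrow> 'a fps \<Rightarrow> bool" where
  "fps_agree n f g \<longleftrightarrow> (\<forall>i\<le>n. fps_nth f i = fps_nth g i)"

lemma fps_agree_mult: "fps_agree n f f' \<Longrightarrow> fps_agree n g g' \<Longrightarrow> fps_agree n (f * g) (f' * g')"
  by (auto simp: fps_agree_def fps_mult_nth intro!: sum.cong)

lemma fps_agree_refl: "fps_agree n f f"
  by (simp add: fps_agree_def)

text \<open>By \<open>qbinomial_factorials\<close> the coefficient is P_m / (P_k P_(m-k)). Since n
  is at most k, m - k and m, all three products are congruent to E modulo X^(n+1), which leaves
  1/E.\<close>

lemma qbinomial_agree: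
  fixes E :: "'a::field fps"
  assumes "s > 0" "n \<le> k" "n + k \<le> m"
  defines "E \<equiv> euler_fps oo fps_X ^ s"
  shows "fps_agree n (qbinomial (fps_X ^ s) m k * E) 1"
proof -
  let ?p = "\<lambda>m. \<Prod>i<m. 1 - (fps_X ^ s) ^ Suc i :: 'a fps"
  have p: "fps_agree n (?p m) E" if "n \<le> m" for m
  proof -
    have "fps_nth (?p m) i = fps_nth E i" if "i \<le> n" for i
    proof -
      have "i div s \<le> m"
        using \<open>i \<le> n\<close> \<open>n \<le> m\<close> div_le_dividend[of i s] by linarith
      moreover have "?p m = euler_partial m oo fps_X ^ s"
        using assms(1) by (simp only: euler_partial_compose power_mult)
      ultimately show ?thesis
        by (simp add: E_def fps_nth_compose_X_power euler_partial_nth_eq)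
    qed
    then show ?thesis by (simp add: fps_agree_def)
  qed
  have "fps_nth E 0 = 1"
    by (simp add: E_def)
  then have inv: "E * inverse E = 1"
    using inverse_mult_eq_1'[of E] by simp
  have eq: "qbinomial (fps_X ^ s) m k * ?p k * ?p (m - k) = ?p m"
    using assms by (intro qbinomial_factorials) simp
  have "fps_agree n (qbinomial (fps_X ^ s) m k * ?p k * ?p (m - k) * inverse E)
     (qbinomial (fps_X ^ s) m k * E * E * inverse E)"
    using assms by (intro fps_agree_mult fps_agree_refl p) auto
  moreover have "fps_agree n (?p m * inverse E) (E * inverse E)"
    using assms by (intro fps_agree_mult fps_agree_refl p) auto
  moreover have "qbinomial (fps_X ^ s) m k * E * E * inverse E = qbinomial (fps_X ^ s) m k * E"
    by (simp only: mult.assoc inv mult_1_right)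
  ultimately show ?thesis
    unfolding eq inv by (simp add: fps_agree_def)
qed

text \<open>For N >= 2n only |k - N| <= n can contribute to coefficient n in
  \<open>finite_triple_product\<close>, and there \<open>qbinomial_agree\<close> replaces the
  q-binomial times the Euler product by 1.\<close>

theorem triple_product:
  fixes s t :: nat
  assumes "0 < t" "t < s"
  shows "(\<lambda>N. (\<Prod>n<N. (1 + fps_X ^ (s * n + t)) * (1 + fps_X ^ (s * Suc n - t)))
      * (euler_fps oo fps_X ^ s)) \<longlonglongrightarrow> (weight_gf (theta_exp s t) UNIV :: 'a::field fps)"
proof (rule tendsto_fpsI)
  fix n
  let ?E = "euler_fps oo fps_X ^ s :: 'a fps"
  have "s > 0" using assms by simp
  have "fps_nth ((\<Prod>i<N. (1 + fps_X ^ (s * i + t)) * (1 + fps_X ^ (s * Suc i - t))) * ?E) n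
      = fps_nth (weight_gf (theta_exp s t) UNIV) n" if N: "2 * n \<le> N" for N
  proof -
    let ?e = "\<lambda>k. theta_exp s t (int k - int N)"
    let ?q = "\<lambda>k. qbinomial (fps_X ^ s) (2 * N) k :: 'a fps"
    have *: "?q k * fps_X ^ ?e k * ?E = fps_X ^ ?e k * (?q k * ?E)" for k
      by (simp only: mult_ac)
    have "fps_nth (?q k * fps_X ^ ?e k * ?E) n = (if ?e k = n then 1 else 0)" for k
    proof (cases "?e k \<le> n")
      case True
      have "\<bar>int k - int N\<bar> \<le> int n"
        using True theta_exp_abs_le[OF assms, of "int k - int N"] by linarith
      then have "n \<le> k" "n + k \<le> 2 * N" using N by linarith+
      then have "fps_nth (?q k * ?E) (n - ?e k) = fps_nth 1 (n - ?e k)"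
        using qbinomial_agree[OF \<open>s > 0\<close>, of n k "2 * N"] by (auto simp: fps_agree_def)
      then show ?thesis
        unfolding * fps_X_power_mult_nth using True by auto
    next
      case False
      then show ?thesis
        unfolding * fps_X_power_mult_nth by auto
    qed
    then have "fps_nth ((\<Prod>i<N. (1 + fps_X ^ (s * i + t)) * (1 + fps_X ^ (s * Suc i - t))) * ?E) n
        = (\<Sum>k\<le>2 * N. if ?e k = n then 1 else 0)"
      unfolding finite_triple_product[OF assms] sum_distrib_right fps_sum_nth by simp
    also have "\<dots> = of_nat (card {k \<in> {..2 * N}. ?e k = n})"
      by (simp add: sum.If_cases Int_def)
    also have "card {k \<in> {..2 * N}. ?e k = n} = card {j. theta_exp s t j = n}"
    proof (rule bij_betw_same_card)
      show "bij_betw (\<lambda>k. int k - int N) {k \<in> {..2 * N}. ?e k = n} {j. theta_exp s t j = n}"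
      proof (rule bij_betw_byWitness[where f' = "\<lambda>j. nat (j + int N)"])
        have *: "\<bar>j\<bar> \<le> int N" if "theta_exp s t j = n" for j
          using theta_exp_abs_le[OF assms, of j] that N by linarith
        show "(\<lambda>j. nat (j + int N)) ` {j. theta_exp s t j = n} \<subseteq> {k \<in> {..2 * N}. ?e k = n}"
          using * by (fastforce simp: abs_le_iff)
        show "\<forall>j\<in>{j. theta_exp s t j = n}. int (nat (j + int N)) - int N = j"
          using * by (fastforce simp: abs_le_iff)
      qed auto
    qed
    finally show ?thesis
      by (simp add: weight_gf_def)
  qed
  then show "\<forall>\<^sub>F N in sequentially.
      fps_nth ((\<Prod>i<N. (1 + fps_X ^ (s * i + t)) * (1 + fps_X ^ (s * Suc i - t))) * ?E) n
      = fps_nth (weight_gf (theta_exp s t) UNIV) n"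
    by (rule eventually_mono[OF eventually_ge_at_top[of "2 * n"]])
qed

section \<open>Power series over the field with two elements\<close>

lemma bit_fps_minus: "f - g = (f + g :: bit fps)"
  by (simp add: fps_eq_iff)

lemma bit_fps_double [simp]: "f + f = (0 :: bit fps)"
  by (rule fps_ext) (metis fps_add_nth fps_zero_nth bit_2_eq_0 mult_2 mult_zero_left)

text \<open>Frobenius: in coefficient n of the square the terms for i and n - i cancel in pairs, and
  the middle term, present for even n, is x^2 = x.\<close>

lemma bit_fps_compose_square: "f oo fps_X ^ 2 = (f :: bit fps) ^ 2"
proof (rule fps_ext)
  fix n
  let ?g = "\<lambda>i. fps_nth f i * fps_nth f (n - i)"
  let ?M = "{i \<in> {0..n}. 2 * i = n}"
  have "fps_nth (f ^ 2) n = (\<Sum>i\<in>{0..n}. ?g i)"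
    by (simp add: power2_eq_square fps_mult_nth)
  also have "\<dots> = (\<Sum>i\<in>{i \<in> {0..n}. 2 * i \<noteq> n}. ?g i) + (\<Sum>i\<in>?M. ?g i)"
  proof (subst sum.union_disjoint[symmetric])
    show "sum ?g {0..n} = sum ?g ({i \<in> {0..n}. 2 * i \<noteq> n} \<union> ?M)"
      by (rule sum.cong) auto
  qed auto
  also have "(\<Sum>i\<in>{i \<in> {0..n}. 2 * i \<noteq> n}. ?g i) = 0"
    by (rule sum_involution_eq_0[where h = "\<lambda>i. n - i"])
       (auto simp: mult.commute simp flip: mult_2)
  also have "(\<Sum>i\<in>?M. ?g i) = (if even n then fps_nth f (n div 2) else 0)"
  proof (cases "even n")
    case True
    then have "?M = {n div 2}" by auto
    moreover have "n - n div 2 = n div 2" using True by auto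
    ultimately show ?thesis using True
      by (cases "fps_nth f (n div 2)") auto
  next
    case False
    then have M: "?M = {}" by auto
    show ?thesis unfolding M using False by simp
  qed
  finally show "fps_nth (f oo fps_X ^ 2) n = fps_nth (f ^ 2) n"
    by (simp add: fps_nth_compose_X_power)
qed

lemma fps_compose_X_power_mult:
  assumes "k > 0" "l > 0"
  shows "f oo fps_X ^ (k * l) = (f oo fps_X ^ k :: 'a::idom fps) oo fps_X ^ l"
  using assms
  by (subst fps_compose_assoc[symmetric])
     (simp_all add: fps_X_power_compose mult.commute flip: power_mult)

lemma bit_fps_compose_power_two:
  "f oo fps_X ^ (2 ^ k) = (f :: bit fps) ^ (2 ^ k)"
proof (induction k)
  case (Suc k)
  have "f oo fps_X ^ (2 ^ k * 2) = (f oo fps_X ^ (2 ^ k)) oo fps_X ^ 2"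
    by (rule fps_compose_X_power_mult) auto
  also have "\<dots> = (f ^ (2 ^ k)) ^ 2"
    by (simp only: Suc bit_fps_compose_square)
  finally show ?case
    by (simp only: power_Suc2 power_mult)
qed simp

lemmas bit_fps_compose_powers =
  bit_fps_compose_power_two[of _ 1, simplified] bit_fps_compose_power_two[of _ 2, simplified]
  bit_fps_compose_power_two[of _ 3, simplified]

section \<open>Theta series as quotients of Euler products modulo 2\<close>

abbreviation theta :: "nat \<Rightarrow> nat \<Rightarrow> bit fps" where
  "theta s t \<equiv> weight_gf (theta_exp s t) UNIV"

lemma euler_fps_nonzero [simp]:
  "euler_fps oo fps_X ^ s \<noteq> (0 :: bit fps)"
  "euler_fps \<noteq> (0 :: bit fps)"
proof -
  have "fps_nth (euler_fps oo fps_X ^ s) 0 \<noteq> (0 :: bit)" "fps_nth euler_fps 0 \<noteq> (0 :: bit)"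
    by (simp_all add: fps_nth_compose_X_power)
  then show "euler_fps oo fps_X ^ s \<noteq> (0 :: bit fps)" "euler_fps \<noteq> (0 :: bit fps)"
    by (metis fps_zero_nth)+
qed

lemma filterlim_linear_nat: "k > 0 \<Longrightarrow> filterlim (\<lambda>N. k * N :: nat) at_top sequentially"
  by (rule filterlim_at_top_mono[OF filterlim_ident]) (auto intro!: always_eventually)

lemma euler_partial_times_tendsto:
  "k > 0 \<Longrightarrow> (\<lambda>N. euler_partial (k * N)) \<longlonglongrightarrow> (euler_fps :: 'a::comm_ring_1 fps)"
  by (rule euler_partial_tendsto[OF filterlim_linear_nat])

lemma prod_lessThan_mult:
  fixes g :: "nat \<Rightarrow> 'a::comm_monoid_mult"
  shows "(\<Prod>i<k * N. g (Suc i)) = (\<Prod>n<N. \<Prod>r<k. g (k * n + Suc r))"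
  by (induction N) (simp_all add: prod_lessThan_add add.commute[of k])

lemma euler_partial_bit: "(euler_partial m :: bit fps) = (\<Prod>i<m. 1 + fps_X ^ Suc i)"
  by (simp add: euler_partial_def bit_fps_minus del: power_Suc)

lemma euler_partial_compose_bit:
  "s > 0 \<Longrightarrow> (euler_partial m :: bit fps) oo fps_X ^ s = (\<Prod>i<m. 1 + fps_X ^ (s * Suc i))"
  by (simp add: euler_partial_compose bit_fps_minus del: mult_Suc_right)

text \<open>The pentagonal number theorem modulo 2: the linear factors of the triple product supply
  the exponents 1 and 2 modulo 3, and \<open>?E\<close> the multiples of 3.\<close>

theorem euler_fps_eq_theta: "(euler_fps :: bit fps) = theta 3 1"
proof -
  let ?P = "\<lambda>N. \<Prod>n<N. (1 + fps_X ^ (3 * n + 1)) * (1 + fps_X ^ (3 * Suc n - 1)) :: bit fps"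
  let ?E = "euler_fps oo fps_X ^ 3 :: bit fps"
  define g where "g m = (1 + fps_X ^ m :: bit fps)" for m
  have key: "?P N * (euler_partial (1 * N) oo fps_X ^ 3) = euler_partial (3 * N)" for N
    unfolding euler_partial_compose_bit[OF zero_less_numeral]
    unfolding euler_partial_bit g_def[symmetric]
    by (simp only: prod_lessThan_mult[of g])
       (simp add: prod.distrib[symmetric] eval_nat_numeral mult_ac add_ac)
  have eq: "?P N * ?E * (euler_partial (1 * N) oo fps_X ^ 3) = euler_partial (3 * N) * ?E" for N
    unfolding key[symmetric] by (simp only: mult_ac)
  have lim1: "(\<lambda>N. ?P N * ?E * (euler_partial (1 * N) oo fps_X ^ 3)) \<longlonglongrightarrow> theta 3 1 * ?E"
    by (intro fps_tendsto_mult triple_product fps_tendsto_compose_X_power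
        euler_partial_times_tendsto) auto
  have lim2: "(\<lambda>N. euler_partial (3 * N) * ?E) \<longlonglongrightarrow> euler_fps * ?E"
    by (intro fps_tendsto_mult euler_partial_times_tendsto tendsto_const) auto
  have *: "theta 3 1 * ?E = euler_fps * ?E"
    by (rule LIMSEQ_unique[OF lim1[unfolded eq] lim2])
  then show ?thesis by simp
qed

text \<open>The odd exponents give a(q) / a(q^2), and the remaining factor is a(q^4); modulo 2 this
  is a a^4 / a^2. The exponents 2 j^2 - j are the triangular numbers, each hit once.\<close>

theorem theta_4_1: "theta 4 1 = euler_fps ^ 3"
proof -
  let ?P = "\<lambda>N. \<Prod>n<N. (1 + fps_X ^ (4 * n + 1)) * (1 + fps_X ^ (4 * Suc n - 1)) :: bit fps"
  let ?a = "euler_fps :: bit fps"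
  let ?E = "?a oo fps_X ^ 4"
  define g where "g m = (1 + fps_X ^ m :: bit fps)" for m
  have key: "?P N * (euler_partial (2 * N) oo fps_X ^ 2) = euler_partial (4 * N)" for N
    unfolding euler_partial_compose_bit[OF zero_less_numeral]
    unfolding euler_partial_bit g_def[symmetric]
    by (simp only: prod_lessThan_mult[of "\<lambda>i. g (2 * i)"] prod_lessThan_mult[of g])
       (simp add: prod.distrib[symmetric] eval_nat_numeral mult_ac add_ac)
  have eq: "?P N * ?E * (euler_partial (2 * N) oo fps_X ^ 2) = euler_partial (4 * N) * ?E" for N
    unfolding key[symmetric] by (simp only: mult_ac)
  have lim1: "(\<lambda>N. ?P N * ?E * (euler_partial (2 * N) oo fps_X ^ 2))
      \<longlonglongrightarrow> theta 4 1 * (?a oo fps_X ^ 2)"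
    by (intro fps_tendsto_mult triple_product fps_tendsto_compose_X_power
        euler_partial_times_tendsto) auto
  have lim2: "(\<lambda>N. euler_partial (4 * N) * ?E) \<longlonglongrightarrow> ?a * ?E"
    by (intro fps_tendsto_mult euler_partial_times_tendsto tendsto_const) auto
  have *: "theta 4 1 * (?a oo fps_X ^ 2) = ?a * ?E"
    by (rule LIMSEQ_unique[OF lim1[unfolded eq] lim2])
  moreover have "?a * ?a ^ 4 = ?a ^ 3 * ?a ^ 2"
    by (simp flip: power_Suc power_add)
  ultimately have "theta 4 1 * ?a ^ 2 = ?a ^ 3 * ?a ^ 2"
    by (simp only: bit_fps_compose_powers)
  then show ?thesis
    by (subst (asm) mult_right_cancel) auto
qed

text \<open>The exponents prime to 6 give a(q) a(q^6) / (a(q^2) a(q^3)) by inclusion-exclusion. With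
  the further factor a(q^6) = b^2 this becomes a b^4 / (a^2 b).\<close>

theorem theta_6_1: "theta 6 1 * euler_fps = (euler_fps oo fps_X ^ 3) ^ 3"
proof -
  let ?P = "\<lambda>N. \<Prod>n<N. (1 + fps_X ^ (6 * n + 1)) * (1 + fps_X ^ (6 * Suc n - 1)) :: bit fps"
  let ?a = "euler_fps :: bit fps" and ?b = "euler_fps oo fps_X ^ 3 :: bit fps"
  let ?E = "?a oo fps_X ^ 6"
  define g where "g m = (1 + fps_X ^ m :: bit fps)" for m
  have key: "?P N * (euler_partial (3 * N) oo fps_X ^ 2) * (euler_partial (2 * N) oo fps_X ^ 3)
      = euler_partial (6 * N) * (euler_partial (1 * N) oo fps_X ^ 6)" for N
    unfolding euler_partial_compose_bit[OF zero_less_numeral]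
    unfolding euler_partial_bit g_def[symmetric]
    by (simp only: prod_lessThan_mult[of "\<lambda>i. g (2 * i)"] prod_lessThan_mult[of "\<lambda>i. g (3 * i)"]
         prod_lessThan_mult[of g])
       (simp add: prod.distrib[symmetric] eval_nat_numeral mult_ac add_ac)
  have eq: "?P N * ?E * ((euler_partial (3 * N) oo fps_X ^ 2) * (euler_partial (2 * N) oo fps_X ^ 3))
      = euler_partial (6 * N) * (euler_partial (1 * N) oo fps_X ^ 6) * ?E" for N
    unfolding key[symmetric] by (simp only: mult_ac)
  have lim1: "(\<lambda>N. ?P N * ?E *
        ((euler_partial (3 * N) oo fps_X ^ 2) * (euler_partial (2 * N) oo fps_X ^ 3)))
      \<longlonglongrightarrow> theta 6 1 * ((?a oo fps_X ^ 2) * ?b)"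
    by (intro fps_tendsto_mult triple_product fps_tendsto_compose_X_power
        euler_partial_times_tendsto) auto
  have lim2: "(\<lambda>N. euler_partial (6 * N) * (euler_partial (1 * N) oo fps_X ^ 6) * ?E)
      \<longlonglongrightarrow> ?a * ?E * ?E"
    by (intro fps_tendsto_mult fps_tendsto_compose_X_power euler_partial_times_tendsto
        tendsto_const) auto
  have *: "theta 6 1 * ((?a oo fps_X ^ 2) * ?b) = ?a * ?E * ?E"
    by (rule LIMSEQ_unique[OF lim1[unfolded eq] lim2])
  have "?E = ?b ^ 2"
    using fps_compose_X_power_mult[of 3 2 ?a] by (simp add: bit_fps_compose_square)
  with * have "theta 6 1 * (?a ^ 2 * ?b) = ?a * ?b ^ 2 * ?b ^ 2"
    by (simp only: bit_fps_compose_square)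
  moreover have "theta 6 1 * (?a ^ 2 * ?b) = (theta 6 1 * ?a) * (?a * ?b)"
    by (simp only: power2_eq_square mult_ac)
  moreover have "?a * ?b ^ 2 * ?b ^ 2 = ?b ^ 3 * (?a * ?b)"
    by (simp only: power2_eq_square power3_eq_cube mult_ac)
  ultimately have "(theta 6 1 * ?a) * (?a * ?b) = ?b ^ 3 * (?a * ?b)"
    by (simp only:)
  then show ?thesis by simp
qed

section \<open>Theta series\<close>

lemma weight_gf_mult:
  assumes "\<And>n. finite {x \<in> S. w x = n}" "\<And>n. finite {y \<in> T. v y = n}"
  shows "weight_gf w S * weight_gf v T = weight_gf (\<lambda>(x, y). w x + v y) (S \<times> T)"
proof (rule fps_ext)
  fix n
  let ?A = "\<lambda>i. {x \<in> S. w x = i}" and ?B = "\<lambda>i. {y \<in> T. v y = i}"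
  have "{z \<in> S \<times> T. (case z of (x, y) \<Rightarrow> w x + v y) = n} = (\<Union>i\<in>{0..n}. ?A i \<times> ?B (n - i))"
    by auto
  also have "card \<dots> = (\<Sum>i=0..n. card (?A i) * card (?B (n - i)))"
    by (subst card_UN_disjoint) (use assms in \<open>auto simp: card_cartesian_product\<close>)
  finally show "fps_nth (weight_gf w S * weight_gf v T) n
      = fps_nth (weight_gf (\<lambda>(x, y). w x + v y) (S \<times> T)) n"
    by (simp add: weight_gf_def fps_mult_nth)
qed

lemma weight_gf_reindex:
  assumes "bij_betw f T S" "\<And>x. x \<in> T \<Longrightarrow> w (f x) = v x"
  shows "weight_gf w S = weight_gf v T"
proof -
  have "bij_betw f {x \<in> T. v x = n} {x \<in> S. w x = n}" for n
    using assms by (intro bij_betw_subset[OF assms(1)] equalityI subsetI) (auto simp: bij_betw_def)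
  then have "card {x \<in> S. w x = n} = card {x \<in> T. v x = n}" for n
    by (rule bij_betw_same_card[symmetric])
  then show ?thesis
    by (simp add: weight_gf_def)
qed

lemma weight_gf_Un:
  assumes "\<And>n. finite {x \<in> S. w x = n}" "\<And>n. finite {x \<in> T. w x = n}" "S \<inter> T = {}"
  shows "weight_gf w (S \<union> T) = weight_gf w S + weight_gf w T"
proof (rule fps_ext)
  fix n
  have "{x \<in> S \<union> T. w x = n} = {x \<in> S. w x = n} \<union> {x \<in> T. w x = n}"
    by auto
  also have "card \<dots> = card {x \<in> S. w x = n} + card {x \<in> T. w x = n}"
    using assms by (intro card_Un_disjoint) auto
  finally show "fps_nth (weight_gf w (S \<union> T)) n = fps_nth (weight_gf w S + weight_gf w T) n"
    by (simp add: weight_gf_def)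
qed

lemma weight_gf_shift:
  "fps_X ^ k * weight_gf w S = (weight_gf (\<lambda>x. k + w x) S :: 'a::comm_ring_1 fps)"
proof (rule fps_ext)
  fix n
  have "{x \<in> S. k + w x = n} = (if n < k then {} else {x \<in> S. w x = n - k})"
    by auto
  then show "fps_nth (fps_X ^ k * weight_gf w S :: 'a fps) n = fps_nth (weight_gf (\<lambda>x. k + w x) S) n"
    by (simp add: weight_gf_def fps_X_power_mult_nth)
qed

lemma weight_gf_compose:
  assumes "k > 0"
  shows "weight_gf w S oo fps_X ^ k = (weight_gf (\<lambda>x. k * w x) S :: 'a::comm_ring_1 fps)"
proof (rule fps_ext)
  fix n
  have "{x \<in> S. k * w x = n} = (if k dvd n then {x \<in> S. w x = n div k} else {})"
    using assms by auto
  then show "fps_nth (weight_gf w S oo fps_X ^ k :: 'a fps) n = fps_nth (weight_gf (\<lambda>x. k * w x) S) n"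
    by (simp add: weight_gf_def fps_nth_compose_X_power)
qed

text \<open>Elements moved by \<open>h\<close> come in pairs of equal weight and cancel modulo
  2.\<close>

lemma weight_gf_involution:
  assumes fin: "\<And>n. finite {x \<in> S. w x = n}"
    and h: "\<And>x. x \<in> S \<Longrightarrow> h x \<in> S" "\<And>x. x \<in> S \<Longrightarrow> h (h x) = x"
      "\<And>x. x \<in> S \<Longrightarrow> w (h x) = w x"
  shows "weight_gf w S = (weight_gf w {x \<in> S. h x = x} :: bit fps)"
proof (rule fps_ext)
  fix n
  let ?F = "{x \<in> {x \<in> S. h x = x}. w x = n}" and ?M = "{x \<in> S. w x = n \<and> h x \<noteq> x}"
  have "of_nat (card {x \<in> S. w x = n}) = (\<Sum>x\<in>{x \<in> S. w x = n}. 1 :: bit)"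
    by simp
  also have "\<dots> = (\<Sum>x\<in>?F \<union> ?M. 1)"
    by (rule sum.cong) auto
  also have "(\<Sum>x\<in>?F \<union> ?M. 1 :: bit) = (\<Sum>x\<in>?F. 1) + (\<Sum>x\<in>?M. 1)"
    using fin[of n] by (intro sum.union_disjoint) (auto elim: rev_finite_subset)
  also have "(\<Sum>x\<in>?M. 1 :: bit) = 0"
    by (rule sum_involution_eq_0[where h = h]) (simp_all add: h eq_commute[of _ "h _"])
  also have "(\<Sum>x\<in>?F. 1) + 0 = (of_nat (card ?F) :: bit)"
    by simp
  finally show "fps_nth (weight_gf w S) n = (fps_nth (weight_gf w {x \<in> S. h x = x}) n :: bit)"
    by (simp only: weight_gf_def fps_nth_Abs_fps)
qed

lemma weight_gf_nth_nonzero: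
  assumes "fps_nth (weight_gf w S :: 'a::semiring_1 fps) n \<noteq> 0"
  obtains x where "x \<in> S" "w x = n"
proof -
  have "{x \<in> S. w x = n} \<noteq> {}"
  proof
    assume "{x \<in> S. w x = n} = {}"
    then have "fps_nth (weight_gf w S) n = (0 :: 'a)"
      by (simp only: weight_gf_def fps_nth_Abs_fps card.empty of_nat_0)
    then show False using assms by simp
  qed
  then show ?thesis using that by blast
qed

section \<open>Identities between theta series from substitutions in their quadratic
  exponents\<close>

lemma theta_exp_3_1: "2 * int (theta_exp 3 1 j) = 3 * j ^ 2 - j"
  using theta_exp_int2[of 1 3 j] by (simp add: algebra_simps power2_eq_square)

lemma theta_exp_4_1: "int (theta_exp 4 1 j) = 2 * j ^ 2 - j"
  using theta_exp_int2[of 1 4 j] by (simp add: algebra_simps power2_eq_square)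

lemma theta_exp_6_1: "int (theta_exp 6 1 j) = 3 * j ^ 2 - 2 * j"
  using theta_exp_int2[of 1 6 j] by (simp add: algebra_simps power2_eq_square)

text \<open>Under j = 2 i the exponent becomes 8 times a generalized pentagonal number; under j = 1
  - 2 i it becomes 1 + 4 (3 i^2 - 2 i), so the series reproduces itself.\<close>

theorem theta_6_1_dissection: "theta 6 1 = euler_fps ^ 8 + fps_X * theta 6 1 ^ 4"
proof -
  have fin: "finite {j \<in> S. theta_exp 6 1 j = n}" for n S
    by (rule finite_subset[OF _ finite_theta_exp[of 1 6 n]]) auto
  have "theta 6 1 = weight_gf (theta_exp 6 1) {j. even j} + weight_gf (theta_exp 6 1) {j. odd j}"
    by (subst weight_gf_Un[OF fin fin, symmetric]) (auto intro!: arg_cong[where f = "weight_gf _"])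
  also have "weight_gf (theta_exp 6 1) {j. even j} = (weight_gf (\<lambda>i. 8 * theta_exp 3 1 i) UNIV :: bit fps)"
  proof (rule weight_gf_reindex)
    show "bij_betw (\<lambda>i::int. 2 * i) UNIV {j. even j}"
      by (rule bij_betw_byWitness[where f' = "\<lambda>j. j div 2"]) auto
    fix i :: int
    have "int (theta_exp 6 1 (2 * i)) = 4 * (2 * int (theta_exp 3 1 i))"
      unfolding theta_exp_6_1 theta_exp_3_1 by (simp add: algebra_simps power2_eq_square)
    then show "theta_exp 6 1 (2 * i) = 8 * theta_exp 3 1 i" by linarith
  qed
  also have "\<dots> = theta 3 1 oo fps_X ^ 8"
    by (rule weight_gf_compose[symmetric]) simp
  also have "\<dots> = euler_fps ^ 8"
    by (simp only: bit_fps_compose_powers euler_fps_eq_theta)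
  also have "weight_gf (theta_exp 6 1) {j. odd j} = (weight_gf (\<lambda>i. 1 + 4 * theta_exp 6 1 i) UNIV :: bit fps)"
  proof (rule weight_gf_reindex)
    show "bij_betw (\<lambda>i::int. 1 - 2 * i) UNIV {j. odd j}"
      by (rule bij_betw_byWitness[where f' = "\<lambda>j. (1 - j) div 2"]) auto
    fix i :: int
    have "int (theta_exp 6 1 (1 - 2 * i)) = 1 + 4 * int (theta_exp 6 1 i)"
      unfolding theta_exp_6_1 by (simp add: algebra_simps power2_eq_square)
    then show "theta_exp 6 1 (1 - 2 * i) = 1 + 4 * theta_exp 6 1 i" by linarith
  qed
  also have "\<dots> = fps_X ^ 1 * (theta 6 1 oo fps_X ^ 4)"
    by (simp only: weight_gf_shift weight_gf_compose[OF zero_less_numeral])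
  also have "\<dots> = fps_X * theta 6 1 ^ 4"
    by (simp only: bit_fps_compose_powers power_one_right)
  finally show ?thesis .
qed

text \<open>
  With \<open>u = 1 - 4 j\<close> and \<open>v = 1 - 4 i\<close> the exponent of the term \<open>(j, i)\<close> on the left is
  \<open>(u^2 + 7 v^2) / 8 - 1\<close>. Dividing \<open>u + v sqrt(-7)\<close> by \<open>(1 + sqrt(-7)) / 2\<close> gives
  \<open>U + V sqrt(-7)\<close> with \<open>V = j - i\<close> and \<open>U = 2 v - V\<close>. If \<open>V\<close> is odd then, up to a common sign,
  \<open>U = 1 - 4 x\<close> and \<open>V = 1 - 4 y\<close>, which gives the last summand on the right. If \<open>V\<close> is even then
  complex conjugation of \<open>(U + V sqrt(-7)) / 2\<close>, again up to sign, is an involution whose fixed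
  points \<open>V = 0\<close> and \<open>U = 0\<close> give the other two summands.
\<close>

theorem theta_4_1_times_compose_7:
  defines "\<psi> \<equiv> theta 4 1"
  shows "\<psi> * (\<psi> oo fps_X ^ 7) = (\<psi> oo fps_X ^ 8) + fps_X ^ 6 * (\<psi> oo fps_X ^ 56)
    + fps_X * ((\<psi> oo fps_X ^ 2) * (\<psi> oo fps_X ^ 14))"
proof -
  let ?e = "theta_exp 4 1"
  have fin: "finite {j \<in> UNIV. k * ?e j = n}" if "k > 0" for n k
    by (rule finite_subset[OF _ finite_theta_exp[of 1 4 "n div k"]]) (use that in auto)
  have gf_pair: "(\<psi> oo fps_X ^ k) * (\<psi> oo fps_X ^ l)
      = weight_gf (\<lambda>(x, y). k * ?e x + l * ?e y) (UNIV \<times> UNIV)"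
    if "k > 0" "l > 0" for k l
    unfolding \<psi>_def weight_gf_compose[OF \<open>k > 0\<close>] weight_gf_compose[OF \<open>l > 0\<close>]
    using that by (intro weight_gf_mult fin)
  define w where "w = (\<lambda>(x, y). 1 * ?e x + 7 * ?e y)"
  have wI: "w p = n" if "2 * (fst p)\<^sup>2 - fst p + 7 * (2 * (snd p)\<^sup>2 - snd p) = int n" for p n
  proof -
    have "int (w p) = int n"
      using that by (simp add: w_def theta_exp_4_1[simplified] split_beta)
    then show ?thesis by simp
  qed
  have finw: "finite {p \<in> S. w p = n}" for S n
  proof (rule finite_subset)
    show "{p \<in> S. w p = n} \<subseteq> (\<Union>i\<in>{..n}. {x. ?e x = i}) \<times> (\<Union>i\<in>{..n}. {x. ?e x = i})"
      by (auto simp: w_def)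
    show "finite ((\<Union>i\<in>{..n}. {x. ?e x = i}) \<times> (\<Union>i\<in>{..n}. {x. ?e x = i}))"
      using finite_theta_exp[of 1 4] by simp
  qed
  define Ev where "Ev = {(j :: int, i). even (j - i)}"
  define Od where "Od = {(j :: int, i). odd (j - i)}"
  have "\<psi> * (\<psi> oo fps_X ^ 7) = weight_gf w (UNIV \<times> UNIV)"
    using gf_pair[of 1 7] by (simp add: w_def)
  also have "UNIV \<times> UNIV = Ev \<union> Od" by (auto simp: Ev_def Od_def)
  also have "weight_gf w (Ev \<union> Od) = (weight_gf w Ev + weight_gf w Od :: bit fps)"
    by (intro weight_gf_Un finw) (auto simp: Ev_def Od_def)
  also have "weight_gf w Od = (weight_gf (\<lambda>p. 1 + (\<lambda>(x, y). 2 * ?e x + 14 * ?e y) p) (UNIV \<times> UNIV) :: bit fps)"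
  proof (rule weight_gf_reindex)
    \<comment> \<open>\<open>f\<close> computes (x, y) from (j, i) as in the text above, and
      \<open>g\<close> is its inverse. The common sign is read off from j - i modulo 4 in
      \<open>f\<close> and from the parity of x + y in \<open>g\<close>.\<close>
    define g where "g = (\<lambda>(x, y). if even (x + y) then ((x + y) div 2 + 1 - 4 * y, (x + y) div 2)
       else ((1 - x - y) div 2 - 1 + 4 * y, (1 - x - y) div 2) :: int \<times> int)"
    define f where "f = (\<lambda>(j, i). if (j - i) mod 4 = 1 then (2 * i - (1 - (j - i)) div 4, (1 - (j - i)) div 4)
       else (1 - 2 * i - (1 + (j - i)) div 4, (1 + (j - i)) div 4) :: int \<times> int)"
    have g0: "g (2 * i - y, y) = (i + 1 - 4 * y, i)" for i y
      by (simp add: g_def)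
    have g1: "g (1 - 2 * i - y, y) = (i - 1 + 4 * y, i)" for i y
      by (simp add: g_def)
    have f0: "f (i + 1 - 4 * y, i) = (2 * i - y, y)" for i y
    proof -
      have "(1 - 4 * y) mod 4 = 1" by presburger
      then show ?thesis by (simp add: f_def)
    qed
    have f1: "f (i - 1 + 4 * y, i) = (1 - 2 * i - y, y)" for i y
    proof -
      have "(4 * y - 1) mod 4 \<noteq> 1" by presburger
      then show ?thesis by (simp add: f_def)
    qed
    have dom: "\<exists>i y. p = (2 * i - y, y) \<or> p = (1 - 2 * i - y, y)" for p :: "int \<times> int"
    proof -
      obtain x y where p: "p = (x, y)" by (cases p)
      have "\<exists>i. x = 2 * i - y \<or> x = 1 - 2 * i - y" by presburger
      then show ?thesis by (auto simp: p)
    qed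
    have ran: "\<exists>i y. p = (i + 1 - 4 * y, i) \<or> p = (i - 1 + 4 * y, i)" if "p \<in> Od" for p
    proof -
      obtain j i where p: "p = (j, i)" by (cases p)
      have "odd (j - i)" using that by (simp add: p Od_def)
      then have "\<exists>y. j = i + 1 - 4 * y \<or> j = i - 1 + 4 * y" by presburger
      then show ?thesis by (auto simp: p)
    qed
    show "bij_betw g (UNIV \<times> UNIV) Od"
    proof (rule bij_betw_byWitness[where f' = f])
      show "\<forall>p\<in>UNIV \<times> UNIV. f (g p) = p" using dom by (metis f0 f1 g0 g1)
      show "\<forall>p\<in>Od. g (f p) = p" using ran by (metis f0 f1 g0 g1)
      have "g p \<in> Od" for p using dom[of p] by (auto simp: g0 g1 Od_def)
      then show "g ` (UNIV \<times> UNIV) \<subseteq> Od" by blast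
    qed simp
    fix p :: "int \<times> int"
    obtain i y where "p = (2 * i - y, y) \<or> p = (1 - 2 * i - y, y)" using dom by blast
    moreover have "w (i + 1 - 4 * y, i) = 1 + (2 * ?e (2 * i - y) + 14 * ?e y)"
      by (intro wI, simp only: fst_conv snd_conv theta_exp_4_1
          of_nat_add of_nat_mult of_nat_1 of_nat_numeral) (simp add: algebra_simps power2_eq_square)
    moreover have "w (i - 1 + 4 * y, i) = 1 + (2 * ?e (1 - 2 * i - y) + 14 * ?e y)"
      by (intro wI, simp only: fst_conv snd_conv theta_exp_4_1
          of_nat_add of_nat_mult of_nat_1 of_nat_numeral) (simp add: algebra_simps power2_eq_square)
    ultimately show "w (g p) = 1 + (case p of (x, y) \<Rightarrow> 2 * ?e x + 14 * ?e y)"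
      by (elim disjE) (simp_all only: g0 g1 prod.case)
  qed
  also have "\<dots> = fps_X * ((\<psi> oo fps_X ^ 2) * (\<psi> oo fps_X ^ 14))"
    by (simp only: gf_pair zero_less_numeral weight_gf_shift[of 1, symmetric] power_one_right)
  also have "weight_gf w Ev = ((\<psi> oo fps_X ^ 8) + fps_X ^ 6 * (\<psi> oo fps_X ^ 56) :: bit fps)"
  proof -
    \<comment> \<open>For d = 4 m the map negates V and keeps U; for d = 4 m + 2 it negates U and
      keeps V. In each case the opposite choice would not give integers j and i.\<close>
    define h where "h = (\<lambda>(j, i). let d = j - i in
      if d mod 4 = 0 then (i - 3 * (d div 4), i + d div 4)
      else (3 * (d div 4) + 2 - i, - (d div 4) - i) :: int \<times> int)"
    have Ev_cases: "\<exists>m i. p = (i + 4 * m, i) \<or> p = (i + 4 * m + 2, i)" if "p \<in> Ev" for p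
    proof -
      obtain j i where p: "p = (j, i)" by (cases p)
      then have "even (j - i)" using that by (simp add: Ev_def)
      then have "\<exists>m. j = i + 4 * m \<or> j = i + 4 * m + 2" by presburger
      then show ?thesis by (auto simp: p)
    qed
    have h0: "h (i + 4 * m, i) = (i - 3 * m, i + m)" for i m
      by (simp add: h_def)
    have h2: "h (i + 4 * m + 2, i) = (3 * m + 2 - i, - m - i)" for i m
    proof -
      have "(4 * m + 2) mod 4 = 2" "(4 * m + 2) div 4 = m" by presburger+
      then show ?thesis by (simp add: h_def add.assoc)
    qed
    have h0': "h (i - 3 * m, i + m) = (i + 4 * m, i)" for i m
      using h0[of "i + m" "- m"] by simp
    have h2': "h (3 * m + 2 - i, - m - i) = (i + 4 * m + 2, i)" for i m
      using h2[of "- m - i" m] by (simp add: algebra_simps)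
    have "weight_gf w Ev = (weight_gf w {p \<in> Ev. h p = p} :: bit fps)"
    proof (rule weight_gf_involution[OF finw])
      fix p assume "p \<in> Ev"
      then obtain m i where p: "p = (i + 4 * m, i) \<or> p = (i + 4 * m + 2, i)"
        using Ev_cases by blast
      then show "h p \<in> Ev" by (auto simp: h0 h2 Ev_def)
      show "h (h p) = p" using p by (auto simp: h0 h2 h0' h2')
      have "w (i - 3 * m, i + m) = w (i + 4 * m, i)"
        by (intro wI, simp only: w_def prod.case fst_conv snd_conv theta_exp_4_1
            of_nat_add of_nat_mult of_nat_1 of_nat_numeral) (simp add: algebra_simps power2_eq_square)
      moreover have "w (3 * m + 2 - i, - m - i) = w (i + 4 * m + 2, i)"
        by (intro wI, simp only: w_def prod.case fst_conv snd_conv theta_exp_4_1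
            of_nat_add of_nat_mult of_nat_1 of_nat_numeral) (simp add: algebra_simps power2_eq_square)
      ultimately show "w (h p) = w p"
        using p by (elim disjE) (simp_all only: h0 h2)
    qed
    \<comment> \<open>V = 0 is the diagonal j = i, and U = 0 reads j = 2 - 7 i.\<close>
    also have "{p \<in> Ev. h p = p} = range (\<lambda>i. (i, i)) \<union> range (\<lambda>i. (2 - 7 * i, i))"
    proof (intro equalityI subsetI)
      fix p assume p: "p \<in> {p \<in> Ev. h p = p}"
      then obtain m i where "p = (i + 4 * m, i) \<or> p = (i + 4 * m + 2, i)"
        using Ev_cases by blast
      then show "p \<in> range (\<lambda>i. (i, i)) \<union> range (\<lambda>i. (2 - 7 * i, i))"
      proof
        assume "p = (i + 4 * m, i)"
        then show ?thesis using p by (auto simp: h0)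
      next
        assume *: "p = (i + 4 * m + 2, i)"
        then have "m = - (2 * i)" using p by (auto simp: h2)
        then show ?thesis using * by auto
      qed
    next
      fix p assume "p \<in> range (\<lambda>i. (i, i)) \<union> range (\<lambda>i. (2 - 7 * i, i :: int))"
      then obtain i where "p = (i, i) \<or> p = (2 - 7 * i, i)" by auto
      then show "p \<in> {p \<in> Ev. h p = p}"
        using h0[of i 0] h2[of i "- (2 * i)"] by (auto simp: Ev_def)
    qed
    also have "weight_gf w \<dots> = (weight_gf w (range (\<lambda>i. (i, i))) + weight_gf w (range (\<lambda>i. (2 - 7 * i, i))) :: bit fps)"
      by (intro weight_gf_Un finw) (auto, presburger)
    also have "weight_gf w (range (\<lambda>i. (i, i))) = (weight_gf (\<lambda>i. 8 * ?e i) UNIV :: bit fps)"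
    proof (rule weight_gf_reindex)
      show "bij_betw (\<lambda>i. (i, i)) UNIV (range (\<lambda>i::int. (i, i)))"
        by (auto simp: bij_betw_def inj_on_def)
    qed (simp add: w_def)
    also have "weight_gf w (range (\<lambda>i. (2 - 7 * i, i))) = (weight_gf (\<lambda>i. 6 + 56 * ?e i) UNIV :: bit fps)"
    proof (rule weight_gf_reindex)
      show "bij_betw (\<lambda>i. (2 - 7 * i, i)) UNIV (range (\<lambda>i::int. (2 - 7 * i, i)))"
        by (auto simp: bij_betw_def inj_on_def)
      show "w (2 - 7 * i, i) = 6 + 56 * ?e i" for i
        by (intro wI) (simp add: theta_exp_4_1[simplified] algebra_simps power2_eq_square)
    qed
    finally show ?thesis
      by (simp add: \<psi>_def weight_gf_compose weight_gf_shift)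
  qed
  finally show ?thesis .
qed

section \<open>Algebra in characteristic 2 and the relation between the Euler products of q and
  q^7\<close>

lemma bit_fps_numeral [simp]:
  "(numeral (num.Bit0 k) :: bit fps) = 0" "(numeral (num.Bit1 k) :: bit fps) = 1"
  by (simp_all add: numeral_Bit0 numeral_Bit1)

lemma bit_fps_power_two_add: "(f + g) ^ 2 = f ^ 2 + (g :: bit fps) ^ 2"
  by (simp add: power2_sum)

lemma bit_fps_power_four_add: "(f + g) ^ 4 = f ^ 4 + (g :: bit fps) ^ 4"
proof -
  have "(f + g) ^ 4 = ((f + g) ^ 2) ^ 2"
    by (simp flip: power_mult)
  also have "\<dots> = f ^ 4 + g ^ 4"
    by (simp add: bit_fps_power_two_add flip: power_mult)
  finally show ?thesis .
qed

lemma bit_fps_add_eq_0_iff: "f + g = 0 \<longleftrightarrow> f = (g :: bit fps)"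
  by (metis add_eq_0_iff bit_fps_double bit_fps_minus diff_0 minus_unique add.right_neutral)

text \<open>
  Both \<open>s\<close> and \<open>t\<close> are roots of the same cubic \<open>z^3 + A C z\<close> = const. The second factor below will
  have constant coefficient 1, which forces \<open>s = t\<close>.
\<close>

lemma septic_cubic:
  fixes A C u x :: "bit fps"
  assumes "u ^ 3 = A ^ 3 + C ^ 3 + x * u ^ 6" "A * C = x ^ 2 * u ^ 8"
  defines "s \<equiv> A + C" and "t \<equiv> u + x * u ^ 4"
  shows "(s + t) * (s ^ 2 + s * t + t ^ 2 + A * C) = 0"
proof -
  have "(s + t) * (s ^ 2 + s * t + t ^ 2 + A * C) = (s ^ 3 + A * C * s) + (t ^ 3 + A * C * t)"
    by (simp add: algebra_simps power2_eq_square power3_eq_cube)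
  also have "s ^ 3 + A * C * s = A ^ 3 + C ^ 3"
    by (simp add: s_def algebra_simps power2_eq_square power3_eq_cube)
  also have "t ^ 3 + A * C * t = u ^ 3 + x * u ^ 6"
    unfolding assms(2) by (simp add: t_def algebra_simps eval_nat_numeral)
  finally show ?thesis
    unfolding assms(1) by (simp add: add_ac)
qed

lemma bit_fps_compose_power_mult:
  fixes f :: "bit fps"
  assumes "k > 0"
  shows "f oo fps_X ^ (k * 2) = (f oo fps_X ^ k) ^ 2" "f oo fps_X ^ (k * 8) = (f oo fps_X ^ k) ^ 8"
  using assms by (simp_all add: fps_compose_X_power_mult bit_fps_compose_powers)

text \<open>Since psi = a^3, \<open>theta_4_1_times_compose_7\<close> says u^3 = A^3 + C^3 + X u^6
  for A = a^8, C = X^2 c^8 and u = a c. Then \<open>septic_cubic\<close> extracts the relation A + C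
  = u + X u^4.\<close>

theorem euler_fps_septic:
  defines "a \<equiv> euler_fps :: bit fps" and "c \<equiv> euler_fps oo fps_X ^ 7 :: bit fps"
  shows "a * c = a ^ 8 + fps_X * a ^ 4 * c ^ 4 + fps_X ^ 2 * c ^ 8"
proof -
  let ?X = "fps_X :: bit fps"
  let ?A = "a ^ 8" and ?C = "?X ^ 2 * c ^ 8" and ?u = "a * c"
  have c3: "a ^ 3 oo ?X ^ 7 = c ^ 3"
    by (simp add: a_def c_def fps_compose_power)
  have "a ^ 3 oo ?X ^ 14 = (c ^ 3) ^ 2" "a ^ 3 oo ?X ^ 56 = (c ^ 3) ^ 8"
    using bit_fps_compose_power_mult[of 7 "a ^ 3"] by (simp_all add: c3)
  then have "a ^ 3 * c ^ 3 = (a ^ 3) ^ 8 + ?X ^ 6 * (c ^ 3) ^ 8 + ?X * ((a ^ 3) ^ 2 * (c ^ 3) ^ 2)"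
    using theta_4_1_times_compose_7[unfolded theta_4_1 a_def[symmetric]]
    by (simp only: c3 bit_fps_compose_powers)
  then have "?u ^ 3 = ?A ^ 3 + ?C ^ 3 + ?X * ?u ^ 6"
    by (simp add: power_mult_distrib flip: power_mult)
  moreover have "?A * ?C = ?X ^ 2 * ?u ^ 8"
    by (simp add: power_mult_distrib)
  ultimately have *: "(?A + ?C + (?u + ?X * ?u ^ 4)) * ((?A + ?C) ^ 2
      + (?A + ?C) * (?u + ?X * ?u ^ 4) + (?u + ?X * ?u ^ 4) ^ 2 + ?A * ?C) = 0"
    by (rule septic_cubic)
  have a0: "fps_nth a 0 = 1" "fps_nth c 0 = 1"
    by (simp_all add: a_def c_def fps_nth_compose_X_power)
  \<comment> \<open>At X = 0 both A + C and u + X u^4 equal 1 and A C is 0, so the value is 1 + 1 +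
    1 = 1 modulo 2.\<close>
  have "fps_nth ((?A + ?C) ^ 2 + (?A + ?C) * (?u + ?X * ?u ^ 4)
      + (?u + ?X * ?u ^ 4) ^ 2 + ?A * ?C) 0 = 1"
    by (simp add: a0 fps_power_zeroth)
  then have "(?A + ?C) ^ 2 + (?A + ?C) * (?u + ?X * ?u ^ 4)
      + (?u + ?X * ?u ^ 4) ^ 2 + ?A * ?C \<noteq> 0"
    by (metis fps_zero_nth zero_neq_one)
  with * have "?A + ?C + (?u + ?X * ?u ^ 4) = 0"
    by (simp only: mult_eq_0_iff simp_thms)
  then have "?A + ?C + ?X * ?u ^ 4 + ?u = 0"
    by (simp only: add_ac)
  then show ?thesis
    by (simp add: bit_fps_add_eq_0_iff power_mult_distrib add_ac mult_ac)
qed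

section \<open>The 4-dissection\<close>

text \<open>The relation theta a = b^3 trades the denominator a for b^4, which is a series in X^4
  and so does not mix exponents of different residues modulo 4.\<close>

theorem euler_quotient_dissection:
  fixes G :: "bit fps"
  defines "a \<equiv> euler_fps" and "b \<equiv> euler_fps oo fps_X ^ 3" and "d \<equiv> euler_fps oo fps_X ^ 21"
  assumes G: "G * a = d"
  shows "fps_nth G (4 * n) = fps_nth (a ^ 2 * b + fps_X * (theta 6 1 * d)) n"
proof -
  let ?X = "fps_X :: bit fps"
  define \<theta> where "\<theta> = theta 6 1"
  have b_nz: "b \<noteq> 0" by (simp add: b_def)
  define B where "B = inverse b"
  have "fps_nth b 0 \<noteq> 0"
    by (simp add: b_def fps_nth_compose_X_power)
  then have B: "B * b = 1"
    by (simp add: B_def inverse_mult_eq_1)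
  have "(euler_fps oo ?X ^ 7) oo ?X ^ 3 = d"
    using fps_compose_X_power_mult[of 7 3 "euler_fps :: bit fps"] by (simp add: d_def)
  then have bd: "b * d = b ^ 8 + ?X ^ 3 * b ^ 4 * d ^ 4 + ?X ^ 6 * d ^ 8"
    using arg_cong[OF euler_fps_septic, of "\<lambda>f. f oo ?X ^ 3"]
    by (simp add: fps_compose_add_distrib fps_compose_mult_distrib fps_compose_power[symmetric]
        fps_X_power_compose b_def power_mult[symmetric])
  have \<theta>: "\<theta> = a ^ 8 + ?X * \<theta> ^ 4" "\<theta> * a = b ^ 3"
    using theta_6_1_dissection theta_6_1 by (simp_all add: \<theta>_def a_def b_def)
  \<comment> \<open>Expanding (b d) theta gives six terms. Those with exponent divisible by 4 add up
    to (H b)^4, those of residue r to X^r (Kr b)^4. \<open>B\<close> enters because the terms with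
    d^8 lack the factor b^4.\<close>
  define H where "H = a ^ 2 * b + ?X * (\<theta> * d)"
  define K1 where "K1 = b * \<theta>"
  define K2 where "K2 = ?X * a ^ 2 * d ^ 2 * B"
  define K3 where "K3 = a ^ 2 * d + ?X * \<theta> * d ^ 2 * B"
  have Kb: "K2 * b = ?X * a ^ 2 * d ^ 2" "K3 * b = a ^ 2 * d * b + ?X * \<theta> * d ^ 2"
    using B by (simp_all add: K2_def K3_def mult.assoc distrib_right)
  have X_powers: "?X ^ 2 = ?X * ?X" "?X ^ 3 = ?X * ?X * ?X" "?X ^ 4 = ?X * ?X * ?X * ?X"
    "?X ^ 6 = ?X * ?X * ?X * ?X * ?X * ?X" "?X ^ 7 = ?X * ?X * ?X * ?X * ?X * ?X * ?X"
    by (simp_all add: eval_nat_numeral mult_ac)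
  have "G * b ^ 4 = G * b ^ 3 * b"
    by (simp add: eval_nat_numeral mult_ac)
  also have "\<dots> = G * a * \<theta> * b"
    unfolding \<theta>(2)[symmetric] by (simp only: mult_ac)
  also have "\<dots> = (b * d) * \<theta>"
    unfolding G by (simp only: mult_ac)
  also have "\<dots> = (b ^ 8 + ?X ^ 3 * b ^ 4 * d ^ 4 + ?X ^ 6 * d ^ 8) * (a ^ 8 + ?X * \<theta> ^ 4)"
    using bd \<theta>(1) by (rule arg_cong2)
  also have "\<dots> = (H * b) ^ 4 + ?X * (K1 * b) ^ 4 + ?X ^ 2 * (K2 * b) ^ 4 + ?X ^ 3 * (K3 * b) ^ 4"
    unfolding Kb H_def K1_def distrib_right bit_fps_power_four_add
    by (simp add: X_powers power_mult_distrib algebra_simps flip: power_mult)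
  also have "\<dots> = (H ^ 4 + ?X * K1 ^ 4 + ?X ^ 2 * K2 ^ 4 + ?X ^ 3 * K3 ^ 4) * b ^ 4"
    by (simp add: power_mult_distrib algebra_simps)
  finally have "G = H ^ 4 + ?X * K1 ^ 4 + ?X ^ 2 * K2 ^ 4 + ?X ^ 3 * K3 ^ 4"
    using b_nz by simp
  also have "\<dots> = (H oo ?X ^ 4) + ?X ^ 1 * (K1 oo ?X ^ 4) + ?X ^ 2 * (K2 oo ?X ^ 4)
      + ?X ^ 3 * (K3 oo ?X ^ 4)"
    by (simp only: bit_fps_compose_powers power_one_right)
  also have "fps_nth \<dots> (4 * n) = fps_nth H n"
  proof -
    have "fps_nth (?X ^ r * (K oo ?X ^ 4)) (4 * n) = 0" if "0 < r" "r < 4" for r K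
    proof -
      have "\<not> 4 dvd 4 * n - r" if "r \<le> 4 * n"
        using that \<open>0 < r\<close> \<open>r < 4\<close> by presburger
      then show ?thesis
        by (simp add: fps_X_power_mult_nth fps_nth_compose_X_power)
    qed
    then show ?thesis
      by (simp only: fps_add_nth) (simp add: fps_nth_compose_X_power)
  qed
  finally show ?thesis by (simp only: H_def \<theta>_def)
qed

section \<open>Quadratic forms representing 24 n + 5\<close>

lemma theta_product_nonzero:
  fixes s s' k k' :: nat
  assumes "fps_nth ((theta s 1 oo fps_X ^ k) * (theta s' 1 oo fps_X ^ k')) n \<noteq> 0"
    and "1 < s" "1 < s'" "0 < k" "0 < k'"
  obtains x y where "n = k * theta_exp s 1 x + k' * theta_exp s' 1 y"
proof -
  have fin: "finite {j \<in> UNIV. k * theta_exp s 1 j = n}" if "k > 0" "1 < s" for n k s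
    by (rule finite_subset[OF _ finite_theta_exp[of 1 s "n div k"]]) (use that in auto)
  have "(theta s 1 oo fps_X ^ k) * (theta s' 1 oo fps_X ^ k')
      = weight_gf (\<lambda>(x, y). k * theta_exp s 1 x + k' * theta_exp s' 1 y) (UNIV \<times> UNIV)"
    unfolding weight_gf_compose[OF \<open>0 < k\<close>] weight_gf_compose[OF \<open>0 < k'\<close>]
    using assms(2-5) by (intro weight_gf_mult fin)
  with assms(1) obtain p
    where "(\<lambda>(x, y). k * theta_exp s 1 x + k' * theta_exp s' 1 y) p = n"
    by (metis weight_gf_nth_nonzero)
  then show ?thesis
    using that by (auto simp: split_beta)
qed

text \<open>Completing squares: 24 e + 1 = (6 j - 1)^2 for e = (3 j^2 - j) / 2, and 3 e + 1 = (3 j -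
  1)^2 for e = 3 j^2 - 2 j.\<close>

theorem euler_quotient_support:
  fixes G :: "bit fps"
  assumes "G * euler_fps = (euler_fps oo fps_X ^ 21)" "fps_nth G (4 * n) \<noteq> 0"
  shows "\<exists>x y :: int. 24 * int n + 5 = 2 * x ^ 2 + 3 * y ^ 2
    \<or> 24 * int n + 5 = 8 * x ^ 2 + 21 * y ^ 2"
proof -
  let ?a = "euler_fps :: bit fps" and ?X = "fps_X :: bit fps"
  have "fps_nth (?a ^ 2 * (?a oo ?X ^ 3) + ?X * (theta 6 1 * (?a oo ?X ^ 21))) n \<noteq> 0"
    using assms(2) unfolding euler_quotient_dissection[OF assms(1)] .
  then consider "fps_nth (?a ^ 2 * (?a oo ?X ^ 3)) n \<noteq> 0"
    | "fps_nth (?X * (theta 6 1 * (?a oo ?X ^ 21))) n \<noteq> 0"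
    by (metis fps_add_nth add_0)
  then show ?thesis
  proof cases
    case 1
    then have "fps_nth ((theta 3 1 oo ?X ^ 2) * (theta 3 1 oo ?X ^ 3)) n \<noteq> 0"
      by (simp only: euler_fps_eq_theta bit_fps_compose_powers not_False_eq_True)
    then obtain x y where n: "n = 2 * theta_exp 3 1 x + 3 * theta_exp 3 1 y"
      by (rule theta_product_nonzero) auto
    have "24 * int n + 5 = 24 * (2 * int (theta_exp 3 1 x)) + 36 * (2 * int (theta_exp 3 1 y)) + 5"
      by (simp add: n)
    also have "\<dots> = 2 * (6 * x - 1) ^ 2 + 3 * (6 * y - 1) ^ 2"
      unfolding theta_exp_3_1 by (simp add: power2_eq_square algebra_simps)
    finally show ?thesis by blast
  next
    case 2
    then have "n > 0" "fps_nth (theta 6 1 * (?a oo ?X ^ 21)) (n - 1) \<noteq> 0"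
      by (auto simp: fps_X_mult_nth split: if_splits)
    then have "fps_nth ((theta 6 1 oo ?X ^ 1) * (theta 3 1 oo ?X ^ 21)) (n - 1) \<noteq> 0"
      by (simp only: euler_fps_eq_theta power_one_right fps_compose_fps_X not_False_eq_True)
    then obtain x y where "n - 1 = 1 * theta_exp 6 1 x + 21 * theta_exp 3 1 y"
      by (rule theta_product_nonzero) auto
    \<comment> \<open>The factor X lowers the index by one, and 24 + 5 = 8 + 21 completes both
      squares.\<close>
    then have "24 * int n + 5 = 24 * int (theta_exp 6 1 x) + 252 * (2 * int (theta_exp 3 1 y)) + 29"
      using \<open>n > 0\<close> by linarith
    also have "\<dots> = 8 * (3 * x - 1) ^ 2 + 21 * (6 * y - 1) ^ 2"
      unfolding theta_exp_3_1 theta_exp_6_1 by (simp add: power2_eq_square algebra_simps)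
    finally show ?thesis by blast
  qed
qed

section \<open>Quadratic residues\<close>

lemma Legendre_values: "Legendre a p \<in> {-1, 0, 1}"
  by (simp add: Legendre_def)

text \<open>Two such values differ by at most 2 < p. This turns the congruences of Euler's criterion
  into equations.\<close>

lemma sign_cong_imp_eq:
  fixes a b p :: int
  assumes "[a = b] (mod p)" "a \<in> {-1, 0, 1}" "b \<in> {-1, 0, 1}" "p > 2"
  shows "a = b"
proof (rule ccontr)
  assume "a \<noteq> b"
  moreover have "p dvd a - b"
    using assms(1) by (simp add: cong_iff_dvd_diff)
  ultimately have "\<bar>p\<bar> \<le> \<bar>a - b\<bar>"
    by (intro dvd_imp_le_int) auto
  then show False using assms by auto
qed

lemma Legendre_mult:
  fixes p :: nat
  assumes "prime p" "p > 2"
  shows "Legendre (a * b) p = Legendre a p * Legendre b p"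
proof (rule sign_cong_imp_eq[where p = p])
  have "[Legendre a p * Legendre b p = a ^ ((p - 1) div 2) * b ^ ((p - 1) div 2)] (mod p)"
    by (intro cong_mult euler_criterion assms)
  then show "[Legendre (a * b) p = Legendre a p * Legendre b p] (mod p)"
    using euler_criterion[OF assms, of "a * b"]
    by (metis cong_sym cong_trans power_mult_distrib)
  show "Legendre a p * Legendre b p \<in> {-1, 0, 1}"
    using Legendre_values[of a p] Legendre_values[of b p] by auto
qed (use assms Legendre_values in auto)

lemma Legendre_minus_1:
  fixes p :: nat
  assumes "prime p" "p > 2"
  shows "Legendre (-1) p = (-1) ^ ((p - 1) div 2)"
proof (rule sign_cong_imp_eq[where p = p])
  show "(-1 :: int) ^ ((p - 1) div 2) \<in> {-1, 0, 1}"
    by (cases "even ((p - 1) div 2)") auto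
qed (use assms euler_criterion Legendre_values in auto)

text \<open>Gauss's lemma: the sign is (-1)^|E|, where E consists of those among 2, 4, ..., p - 1
  that exceed h = (p - 1) / 2. These are 2 x with h div 2 < x <= h, and the parity of their number
  depends on h modulo 4.\<close>

lemma Legendre_2:
  fixes p :: nat
  assumes "prime p" "p > 2"
  shows "Legendre 2 p = (if p mod 8 \<in> {1, 7} then 1 else -1)"
proof -
  have "[2 \<noteq> 0] (mod int p)"
    using assms by (auto simp: cong_def)
  then interpret GAUSS p 2
    using assms by unfold_locales auto
  define h where "h = (int p - 1) div 2"
  have p: "int p = 2 * h + 1" using p_eq2 by (simp add: h_def)
  then have "h > 0" using assms by linarith
  have "C = (\<lambda>x. x * 2) ` {0<..h}"
    unfolding C_def B_def A_def h_def[symmetric] image_image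
    by (rule image_cong[OF refl]) (use p in auto)
  then have "E = (\<lambda>x. x * 2) ` {h div 2<..h}"
    unfolding E_def h_def[symmetric] using \<open>h > 0\<close> by auto
  then have "card E = nat (h - h div 2)"
    by (simp add: card_image inj_on_def)
  moreover obtain k where k: "h = int k"
    using \<open>h > 0\<close> by (metis zero_less_imp_eq_int)
  ultimately have "card E = k - k div 2"
    by linarith
  moreover have "p = 2 * k + 1" using p k by linarith
  moreover have "even (k - k div 2) \<longleftrightarrow> (2 * k + 1) mod 8 = 1 \<or> (2 * k + 1) mod 8 = 7"
  proof -
    have "\<exists>q. k = 4 * q \<or> k = 4 * q + 1 \<or> k = 4 * q + 2 \<or> k = 4 * q + 3"
      by presburger
    then obtain q where "k = 4 * q \<or> k = 4 * q + 1 \<or> k = 4 * q + 2 \<or> k = 4 * q + 3"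
      by blast
    then show ?thesis
    proof (elim disjE)
      assume "k = 4 * q"
      then show ?thesis by simp
    next
      assume "k = 4 * q + 1"
      moreover from this have "k - k div 2 = 2 * q + 1" "(2 * k + 1) mod 8 = 3" by presburger+
      ultimately show ?thesis by simp
    next
      assume "k = 4 * q + 2"
      moreover from this have "k - k div 2 = 2 * q + 1" "(2 * k + 1) mod 8 = 5" by presburger+
      ultimately show ?thesis by simp
    next
      assume "k = 4 * q + 3"
      moreover from this have "k - k div 2 = 2 * (q + 1)" "(2 * k + 1) mod 8 = 7" by presburger+
      ultimately show ?thesis by simp
    qed
  qed
  ultimately have "even (card E) \<longleftrightarrow> p mod 8 \<in> {1, 7}"
    by simp
  then show ?thesis
    using gauss_lemma by auto
qed

text \<open>Makes residuosity modulo 3 and 7 a finite check.\<close>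

lemma QuadRes_iff:
  assumes "p > 0"
  shows "QuadRes p a \<longleftrightarrow> (\<exists>y\<in>{0..<p}. y ^ 2 mod p = a mod p)"
proof
  assume "QuadRes p a"
  then obtain y where "y ^ 2 mod p = a mod p"
    by (auto simp: QuadRes_def cong_def)
  then have "(y mod p) ^ 2 mod p = a mod p"
    by (simp add: power_mod)
  then show "\<exists>y\<in>{0..<p}. y ^ 2 mod p = a mod p"
    using assms by (intro bexI[of _ "y mod p"]) auto
qed (auto simp: QuadRes_def cong_def)

lemma Legendre_mod_3:
  assumes "n mod 3 \<noteq> 0"
  shows "Legendre n 3 = (if n mod 3 = 1 then 1 else -1)"
proof -
  have "{0..<3} = {0, 1, 2 :: int}" by auto
  moreover have "n mod 3 = 1 \<or> n mod 3 = 2" using assms by presburger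
  ultimately show ?thesis
    using assms by (auto simp: Legendre_def QuadRes_iff cong_def)
qed

lemma Legendre_mod_7:
  assumes "n mod 7 \<noteq> 0"
  shows "Legendre n 7 = (if n mod 7 \<in> {1, 2, 4} then 1 else -1)"
proof -
  have "{0..<7} = {0, 1, 2, 3, 4, 5, 6 :: int}" by auto
  moreover have "n mod 7 \<in> {1, 2, 3, 4, 5, 6}" using assms by simp presburger
  ultimately show ?thesis
    using assms by (auto simp: Legendre_def QuadRes_iff cong_def)
qed

lemma prime_7: "prime (7 :: nat)"
  by (simp add: prime_nat_numeral_eq)

text \<open>The symbol of p modulo 3 is 1 or -1, hence its own inverse, so multiplying the
  reciprocity law by it isolates the symbol of 3.\<close>

lemma Legendre_3:
  fixes p :: nat
  assumes "prime p" "p > 3"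
  shows "Legendre 3 p = (-1) ^ ((p - 1) div 2) * Legendre p 3"
proof -
  have "\<not> 3 dvd p"
    using assms primes_dvd_imp_eq[of 3 p] by auto
  then have "int p mod 3 \<noteq> 0" by presburger
  then have "Legendre p 3 * Legendre p 3 = 1"
    by (simp add: Legendre_mod_3)
  moreover have "Legendre p 3 * Legendre 3 p = (-1) ^ ((p - 1) div 2)"
    using Quadratic_Reciprocity[of p 3] assms by simp
  ultimately show ?thesis
    by (metis mult.assoc mult.commute mult_1)
qed

lemma Legendre_7:
  fixes p :: nat
  assumes "prime p" "p > 7"
  shows "Legendre 7 p = (-1) ^ ((p - 1) div 2) * Legendre p 7"
proof -
  have "\<not> 7 dvd p"
    using assms primes_dvd_imp_eq[of 7 p] prime_7 by auto
  then have "int p mod 7 \<noteq> 0" by presburger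
  then have "Legendre p 7 * Legendre p 7 = 1"
    by (simp add: Legendre_mod_7)
  \<comment> \<open>The factor 3 in the exponent is (7 - 1) / 2; being odd, it does not change the
    sign.\<close>
  moreover have "Legendre p 7 * Legendre 7 p = (-1) ^ ((p - 1) div 2 * 3)"
    using Quadratic_Reciprocity[of p 7] assms prime_7 by simp
  moreover have "(-1 :: int) ^ ((p - 1) div 2 * 3) = (-1) ^ ((p - 1) div 2)"
    by (simp add: minus_one_power_iff)
  ultimately show ?thesis
    by (metis mult.assoc mult.commute mult_1)
qed

text \<open>The signs (-1)^((p-1)/2) from -1 and 3 cancel, so -6 has symbol (2/p)(p/3); for -42 this
  is multiplied by (7/p) = (-1)^((p-1)/2) (p/7).\<close>

lemma Legendre_minus_6_42:
  fixes p :: nat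
  assumes p: "prime p" "p > 7"
    and r: "p mod 168 \<in> {19, 37, 47, 65, 85, 109, 113, 115, 137, 139, 143, 167}"
  shows "Legendre (-6) p = -1" "Legendre (-42) p = -1"
proof -
  define s :: int where "s = (-1) ^ ((p - 1) div 2)"
  have ss: "s * s = 1" by (simp add: s_def flip: power_add)
  have eqs: "p mod 8 = p mod 168 mod 8" "int p mod 3 = int (p mod 168) mod 3"
    "int p mod 7 = int (p mod 168) mod 7" "p mod 4 = p mod 168 mod 4" "odd p \<longleftrightarrow> odd (p mod 168)"
    by (simp_all add: mod_mod_cancel zmod_int dvd_mod_iff)
  \<comment> \<open>Checked on the twelve classes: (2/p) = -(p/3), and (p/7) = 1 exactly when p is 1
    modulo 4.\<close>
  have *: "(p mod 8 \<in> {1, 7} \<longleftrightarrow> int p mod 3 \<noteq> 1) \<and> int p mod 3 \<noteq> 0 \<and> int p mod 7 \<noteq> 0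
      \<and> (p mod 4 = 1 \<longleftrightarrow> int p mod 7 \<in> {1, 2, 4}) \<and> odd p"
    unfolding eqs using r by (elim insertE) simp_all
  have "Legendre (-6) p = Legendre (-1) p * Legendre 2 p * Legendre 3 p"
    using Legendre_mult[of p "-1" "6"] Legendre_mult[of p 2 3] p by simp
  also have "\<dots> = (s * s) * (Legendre 2 p * Legendre p 3)"
    using p by (simp add: Legendre_minus_1 Legendre_3 s_def)
  also have "\<dots> = -1"
    using * p by (simp add: ss Legendre_2 Legendre_mod_3)
  finally show 6: "Legendre (-6) p = -1" .
  have "odd p" using * by blast
  then have "even ((p - 1) div 2) \<longleftrightarrow> p mod 4 = 1"
    by presburger
  then have "s = (if p mod 4 = 1 then 1 else -1)"
    by (simp add: s_def minus_one_power_iff)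
  moreover have "Legendre 7 p = s * Legendre p 7"
    using p by (simp add: Legendre_7 s_def)
  ultimately have "Legendre 7 p = 1"
    using * by (simp add: Legendre_mod_7)
  then show "Legendre (-42) p = -1"
    using Legendre_mult[of p "-6" 7] p 6 by simp
qed

text \<open>If y had an inverse z modulo p, then (A x z)^2 would be -A B modulo p. So p divides y.
  As 0 counts as a square in \<open>QuadRes\<close>, p does not divide A, hence p divides x
  too.\<close>

lemma binary_form_prime_sq_dvd:
  fixes p A B x y :: int
  assumes p: "prime p" and "\<not> QuadRes p (- (A * B))" and dvd: "p dvd A * x ^ 2 + B * y ^ 2"
  shows "p ^ 2 dvd A * x ^ 2 + B * y ^ 2"
proof -
  have "p dvd y"
  proof (rule ccontr)
    assume "\<not> p dvd y"
    then have "coprime y p"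
      using p by (simp add: prime_imp_coprime coprime_commute)
    then obtain z where z: "[y * z = 1] (mod p)"
      using cong_solve_coprime_int by blast
    have "[(A * x * z) ^ 2 = A * z ^ 2 * (A * x ^ 2 + B * y ^ 2) - A * B * (y * z) ^ 2] (mod p)"
      by (simp add: algebra_simps power2_eq_square)
    also have "[A * z ^ 2 * (A * x ^ 2 + B * y ^ 2) - A * B * (y * z) ^ 2 = A * z ^ 2 * 0 - A * B * 1 ^ 2] (mod p)"
      using dvd z by (intro cong_diff cong_mult cong_pow cong_refl) (simp_all add: cong_0_iff)
    finally have "QuadRes p (- (A * B))"
      by (auto simp: QuadRes_def)
    then show False using assms by blast
  qed
  moreover have "\<not> p dvd A"
  proof
    assume "p dvd A"
    then have "QuadRes p (- (A * B))"
      unfolding QuadRes_def by (intro exI[of _ 0]) (simp add: cong_sym_eq[of 0] cong_0_iff)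
    then show False using assms by blast
  qed
  ultimately have "p dvd x"
    using dvd p by (metis dvd_add_left_iff dvd_mult prime_dvd_mult_iff
      power2_eq_square)
  with \<open>p dvd y\<close> show ?thesis
    by (meson dvd_add dvd_mult dvd_power_same)
qed

section \<open>The parity of b21\<close>

text \<open>No ring homomorphism leads from \<open>rat\<close> to \<open>bit\<close>, so reduction
  modulo 2 is a relation: corresponding coefficients are images of one integer. It is preserved by
  products.\<close>

lemma b21_partial_product_bit:
  "\<exists>z. fps_nth (\<Prod>k\<le>N. b21_factor k) n = of_int z
    \<and> fps_nth (\<Prod>k\<le>N. \<Sum>j<21. (fps_X ^ Suc k) ^ j) n = (of_int z :: bit)"
proof -
  define R where "R f g \<longleftrightarrow>
    (\<forall>n. \<exists>z. fps_nth f n = rat_of_int z \<and> fps_nth g n = (of_int z :: bit))" for f g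
  have mult: "R (f * f') (g * g')" if "R f g" "R f' g'" for f f' g g'
  proof -
    obtain u v where "\<And>n. fps_nth f n = rat_of_int (u n) \<and> fps_nth g n = of_int (u n)"
      "\<And>n. fps_nth f' n = rat_of_int (v n) \<and> fps_nth g' n = of_int (v n)"
      using \<open>R f g\<close> \<open>R f' g'\<close> unfolding R_def by metis
    then show ?thesis
      unfolding R_def fps_mult_nth
      by (intro allI exI[of _ "\<Sum>i=0..n. u i * v (n - i)" for n]) simp
  qed
  have nth: "fps_nth ((fps_X ^ Suc k) ^ j) n = (of_int (if n = Suc k * j then 1 else 0) :: 'a::ring_1)"
    for k j n
    by (simp add: fps_X_power_nth flip: power_mult del: power_Suc mult_Suc)
  define B where "B k = (\<Sum>j<21. (fps_X ^ Suc k) ^ j :: bit fps)" for k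
  have "R (b21_factor k) (B k)" for k
    unfolding B_def R_def b21_factor_eq fps_sum_nth nth of_int_sum[symmetric] by blast
  then have "R (\<Prod>k\<le>N. b21_factor k) (\<Prod>k\<le>N. B k)"
    by (induction N) (auto intro!: mult)
  then show ?thesis
    unfolding R_def B_def by blast
qed

text \<open>Each geometric sum times 1 - X^(k+1) is 1 - X^(21(k+1)), so both sides are limits of the
  same sequence of partial products.\<close>

theorem b21_mod_2_generating_function:
  "Abs_fps (\<lambda>n. of_int (b21 (int n)) :: bit) * euler_fps = (euler_fps oo fps_X ^ 21)"
proof (rule LIMSEQ_unique)
  let ?P = "\<lambda>N. \<Prod>k\<le>N. \<Sum>j<21. (fps_X ^ Suc k) ^ j :: bit fps"
  have "fps_nth (?P N) n = of_int (b21 (int n))" if "n \<le> N" for n N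
  proof -
    have "fps_nth (\<Prod>k\<le>N. b21_factor k) n = fps_nth (\<Prod>k\<le>n. b21_factor k) n"
      using that by (induction N rule: dec_induct) (simp_all only: b21_partial_product_Suc)
    moreover have "prodinf b21_factor = Abs_fps (\<lambda>n. fps_nth (\<Prod>k\<le>n. b21_factor k) n)"
      using has_prod_unique[OF b21_factor_has_prod] by simp
    ultimately have "b21 (int n) = \<lfloor>fps_nth (\<Prod>k\<le>N. b21_factor k) n\<rfloor>"
      by (simp add: b21_def)
    then show ?thesis
      using b21_partial_product_bit[of N n] by auto
  qed
  then have "?P \<longlonglongrightarrow> Abs_fps (\<lambda>n. of_int (b21 (int n)))"
    by (intro tendsto_fpsI) (auto intro: eventually_mono[OF eventually_ge_at_top])
  then show "(\<lambda>N. ?P N * euler_partial (Suc N)) \<longlonglongrightarrow> Abs_fps (\<lambda>n. of_int (b21 (int n))) * euler_fps"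
    by (intro fps_tendsto_mult euler_partial_tendsto filterlim_Suc)
  have "?P N * euler_partial (Suc N) = (euler_partial (Suc N) oo fps_X ^ 21)" for N
  proof -
    have "(\<Sum>j<21. (fps_X ^ Suc k) ^ j) * (1 - fps_X ^ Suc k) = (1 - fps_X ^ (21 * Suc k) :: bit fps)" for k
    proof -
      have "(1 - fps_X ^ (21 * Suc k) :: bit fps) = 1 - (fps_X ^ Suc k) ^ 21"
        by (simp only: power_mult[symmetric] mult.commute)
      then show ?thesis
        by (simp only: one_diff_power_eq mult.commute)
    qed
    then show ?thesis
      by (simp only: euler_partial_compose zero_less_numeral)
         (simp only: euler_partial_def lessThan_Suc_atMost prod.distrib[symmetric])
  qed
  then show "(\<lambda>N. ?P N * euler_partial (Suc N)) \<longlonglongrightarrow> (euler_fps oo fps_X ^ 21)"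
    by (simp only: fps_tendsto_compose_X_power euler_partial_tendsto filterlim_Suc)
qed

lemma odd_b21_representation:
  assumes "odd (b21 (4 * m))"
  shows "\<exists>x y. 24 * m + 5 = 2 * x ^ 2 + 3 * y ^ 2 \<or> 24 * m + 5 = 2 * x ^ 2 + 21 * y ^ 2"
proof -
  \<comment> \<open>At negative arguments \<open>b21\<close> is 0, hence even.\<close>
  have "m \<ge> 0"
    using assms by (auto simp: b21_def split: if_splits)
  then have m: "int (4 * nat m) = 4 * m" by simp
  have "fps_nth (Abs_fps (\<lambda>n. of_int (b21 (int n)) :: bit)) (4 * nat m) \<noteq> 0"
    using assms by (simp only: fps_nth_Abs_fps m) (auto elim!: oddE)
  from euler_quotient_support[OF b21_mod_2_generating_function this] \<open>m \<ge> 0\<close>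
  obtain x y where "24 * m + 5 = 2 * x ^ 2 + 3 * y ^ 2 \<or> 24 * m + 5 = 8 * x ^ 2 + 21 * y ^ 2"
    by auto
  \<comment> \<open>Absorbing the 4 into the square leaves a form with -A B = -42.\<close>
  moreover have "8 * x ^ 2 = 2 * (2 * x) ^ 2" by (simp add: power2_eq_square)
  ultimately show ?thesis by metis
qed

theorem theorem2p8:
  fixes p c n k :: int
  assumes "prime p"
    and "\<exists>r\<in>{19, 37, 47, 65, 85, 109, 113, 115, 137, 139, 143, 167}. [p = r] (mod 168)"
    and "[24 * c = 1] (mod p ^ 2)"
    and "n \<ge> 0"
    and "1 \<le> k" and "k < p"
  shows "[b21 (4 * (p ^ 2 * n + k * p - 5 * c)) = 0] (mod 2)"
proof (rule ccontr)
  define m where "m = p ^ 2 * n + k * p - 5 * c"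
  assume "\<not> ?thesis"
  then have "odd (b21 (4 * m))"
    by (simp add: cong_0_iff m_def)
  then obtain x y where xy: "24 * m + 5 = 2 * x ^ 2 + 3 * y ^ 2 \<or> 24 * m + 5 = 2 * x ^ 2 + 21 * y ^ 2"
    using odd_b21_representation by blast
  have "p > 0" using assms(1) by (rule prime_gt_0_int)
  then have r: "p mod 168 \<in> {19, 37, 47, 65, 85, 109, 113, 115, 137, 139, 143, 167}"
    using assms(2) by (auto simp: cong_def)
  \<comment> \<open>All listed residues are at least 19, and p mod 168 is at most p.\<close>
  have "p \<ge> 19"
    using r zmod_le_nonneg_dividend[of p 168] \<open>p > 0\<close> by auto
  have "nat p mod 168 = nat (p mod 168)"
    using \<open>p > 0\<close> by (simp add: nat_mod_distrib)
  then have "nat p mod 168 \<in> {19, 37, 47, 65, 85, 109, 113, 115, 137, 139, 143, 167}"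
    using r by (elim insertE) simp_all
  moreover have "prime (nat p)"
    using assms(1) \<open>p \<ge> 19\<close> by (subst prime_nat_int_transfer[symmetric]) simp
  moreover have "nat p > 7" "int (nat p) = p"
    using \<open>p \<ge> 19\<close> by linarith+
  ultimately have "Legendre (-6) p = -1" "Legendre (-42) p = -1"
    using Legendre_minus_6_42[of "nat p"] by simp_all
  then have nonres: "\<not> QuadRes p (- (2 * 3))" "\<not> QuadRes p (- (2 * 21))"
    by (auto simp: Legendre_def split: if_splits)
  \<comment> \<open>The 5 completes -5 (24 c - 1), so w is divisible by p^2. The rest, 24 k p,
    contains p only once unless p divides 24 k.\<close>
  define w where "w = p ^ 2 * (24 * n) - 5 * (24 * c - 1)"
  have w: "24 * m + 5 = w + p * (24 * k)"
    by (simp add: m_def w_def algebra_simps)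
  have p2: "p ^ 2 dvd w"
    using assms(3) unfolding w_def cong_iff_dvd_diff by (rule dvd_diff[OF dvd_triv_left dvd_mult])
  moreover have "p dvd p ^ 2" by (simp add: power2_eq_square)
  ultimately have "p dvd w" by (rule dvd_trans[rotated])
  then have "p dvd 24 * m + 5" unfolding w by simp
  then have "p ^ 2 dvd 24 * m + 5"
    using xy binary_form_prime_sq_dvd[OF assms(1) nonres(1)]
      binary_form_prime_sq_dvd[OF assms(1) nonres(2)] by auto
  then have "p ^ 2 dvd p * (24 * k)"
    unfolding w using p2 by (simp only: dvd_add_right_iff)
  then have "p dvd 24 * k"
    using \<open>p > 0\<close> by (simp add: power2_eq_square)
  \<comment> \<open>A prime p cannot divide k because 0 < k < p.\<close>
  then have "p dvd 24"
    using assms(1,5,6) zdvd_not_zless[of k p] by (auto simp: prime_dvd_mult_iff)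
  then have "p \<le> 24" by (rule zdvd_imp_le) simp
  \<comment> \<open>Between 19 and 24 only 19 lies in a listed class.\<close>
  then have "p = 19" using r \<open>p \<ge> 19\<close> by auto
  then show False using \<open>p dvd 24\<close> by simp
qed

end
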